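(* Let $H$ be a separable real Hilbert space with inner product $\langle\cdot,\cdot\rangle$ and norm $\|\cdot\|$, let $X$ be an $H$-valued random variable, and let $X_1,X_2,\ldots$ be i.i.d. copies of $X$. Assume that (i) for every $h\in H$ there exists $h'\in H$ with $\langle h,h'\rangle=0$ and $\mathrm{Var}(\langle h',X\rangle)>0$; (ii) there is a constant $C>0$ such that $\mathbb{E}[\|X-h\|^{-1}]\le C$ and $\mathbb{E}[\|X-h\|^{-2}]\le C$ for all $h\in H$. Let $m$ be the geometric median of $X$ and $$\Gamma_m=\mathbb{E}\left[\frac1{\|X-m\|}\left(I_H-\frac{(X-m)\otimes(X-m)}{\|X-m\|^2}\right)\right].$$ Let $\alpha\in(1/2,1)$, $c_\gamma>0$, $\gamma_n=c_\gamma n^{-\alpha}$ for $n\ge 1$, let $Z_1$ be a bounded $\sigma(X_1)$-measurable $H$-valued random variable, and for $n\ge1$ let $$Z_{n+1}=Z_n+\gamma_n\frac{X_{n+1}-Z_n}{\|X_{n+1}-Z_n\|},\qquad \overline{Z}_n=\frac1n\sum_{i=1}^nZ_i.$$ Then for all $\delta\in(0,1)$ there is a rank $n_\delta$ such that for all $n\ge n_\delta$, $$\mathbb{P}\left[\left\|\Gamma_m(\overline{Z}_n-m)\right\|\le 4\left(\frac{2}{3n}+\frac1{\sqrt n}\right)\ln\left(\frac4\delta\right)\right]\ge1-\delta.$$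
   Context: The geometric median of $X$ is $m:=\arg\min_{h\in H}\mathbb{E}[\|X-h\|-\|X\|]$; under (i) it is uniquely defined. $I_H$ is the identity operator of $H$ and $(u\otimes v)(h)=\langle u,h\rangle v$ for $u,v,h\in H$. Condition (ii) implies $\mathbb{P}(X=h)=0$ for every $h\in H$, so the recursion is almost surely well defined. *)

theory Defs
  imports "HOL-Probability.Probability"
begin

(* Variance with values in [0, \<infinity>]: no moment of the variable is assumed to exist. If Y is
   integrable this is E[(Y - E Y)^2], possibly \<infinity>. If Y is not integrable, its Bochner
   integral is 0 by convention and the value is E[Y^2] = \<infinity>. The library's real-valued
   variance would be 0 as soon as Y is not square integrable. *)
definition ext_variance :: "'w measure \<Rightarrow> ('w \<Rightarrow> real) \<Rightarrow> ennreal" where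
  "ext_variance M Y = (\<integral>\<^sup>+\<omega>. ennreal ((Y \<omega> - (\<integral>\<omega>'. Y \<omega>' \<partial>M))\<^sup>2) \<partial>M)"

(* Subtracting norm (X \<omega>) makes the integrand bounded (by norm h), hence integrable for every X. *)
definition median_objective ::
    "'w measure \<Rightarrow> ('w \<Rightarrow> 'a::real_normed_vector) \<Rightarrow> 'a \<Rightarrow> real" where
  "median_objective M X h = (\<integral>\<omega>. (norm (X \<omega> - h) - norm (X \<omega>)) \<partial>M)"

definition is_geometric_median ::
    "'w measure \<Rightarrow> ('w \<Rightarrow> 'a::real_normed_vector) \<Rightarrow> 'a \<Rightarrow> bool" where
  "is_geometric_median M X m \<longleftrightarrow> is_arg_min (median_objective M X) (\<lambda>_. True) m"

definition tensor_op :: "'a::real_inner \<Rightarrow> 'a \<Rightarrow> 'a \<Rightarrow> 'a" where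
  "tensor_op u v h = (u \<bullet> h) *\<^sub>R v"

(* Expectation of a random operator in the strong sense: (E T) h = E [T h] for every h, a Bochner
   integral in the Hilbert space. The library's Bochner integral needs a second countable
   codomain, which the space of bounded operators with the operator norm is not in infinite
   dimension; when T is Bochner integrable in operator norm, both expectations coincide. *)
definition op_expectation ::
    "'w measure \<Rightarrow> ('w \<Rightarrow> 'a \<Rightarrow> 'a::{banach, second_countable_topology}) \<Rightarrow> 'a \<Rightarrow> 'a" where
  "op_expectation M T h = (\<integral>\<omega>. T \<omega> h \<partial>M)"

definition Gamma_op ::
    "'w measure \<Rightarrow> ('w \<Rightarrow> 'a::{real_inner, banach, second_countable_topology})
      \<Rightarrow> 'a \<Rightarrow> 'a \<Rightarrow> 'a" where
  "Gamma_op M X m = op_expectation M (\<lambda>\<omega> h.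
     (1 / norm (X \<omega> - m)) *\<^sub>R
       (id h - (1 / (norm (X \<omega> - m))\<^sup>2) *\<^sub>R tensor_op (X \<omega> - m) (X \<omega> - m) h))"

definition avg_seq :: "(nat \<Rightarrow> 'w \<Rightarrow> 'a::real_vector) \<Rightarrow> nat \<Rightarrow> 'w \<Rightarrow> 'a" where
  "avg_seq Z n \<omega> = (1 / real n) *\<^sub>R (\<Sum>i=1..n. Z i \<omega>)"

end

theory Submission
  imports Defs
begin

text \<open>
Let \<open>\<Phi> h = - E ((X - h) / \<bar>X - h\<bar>)\<close> be the gradient of the median objective, \<open>T\<^sub>k = Z\<^sub>k - m\<close>,
and let \<open>\<xi>\<^sub>k\<close> be the centred noise of the step from \<open>Z\<^sub>k\<close> to \<open>Z\<^sub>k\<^sub>+\<^sub>1\<close>, so that the recursion reads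
\<open>\<Phi> Z\<^sub>k = \<xi>\<^sub>k + (T\<^sub>k - T\<^sub>k\<^sub>+\<^sub>1) / \<gamma>\<^sub>k\<close>. The median is a zero of \<open>\<Phi>\<close> and \<open>\<Gamma>\<close> is the derivative of \<open>\<Phi>\<close> there;
the inverse second moment makes the Taylor remainder quadratic. Summing over \<open>k \<le> n\<close> gives

\<open>n \<Gamma> (Zbar\<^sub>n - m) = \<Sum> \<xi>\<^sub>k + \<Sum> (T\<^sub>k - T\<^sub>k\<^sub>+\<^sub>1) / \<gamma>\<^sub>k + O(\<Sum> \<bar>T\<^sub>k\<bar>^2)\<close>

(lemma \<open>norm_Gamma_avg_le\<close>). The first sum is a martingale with increments of norm at most 2. By a
dimension-free Azuma-Hoeffding inequality (\<open>azuma_hoeffding\<close>) it exceeds \<open>3 sqrt n ln (4 / \<delta>)\<close> with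
probability at most \<open>\<delta> / 2\<close>. The other two terms are \<open>o(sqrt n)\<close> in probability
(\<open>remainder_negligible\<close>), so for large \<open>n\<close> they exceed the remaining \<open>sqrt n ln (4 / \<delta>)\<close> with probability
at most \<open>\<delta> / 2\<close>.

The remainder is small because \<open>E \<bar>T\<^sub>n\<bar>^2 = O(n^(-\<alpha>))\<close> on an event of probability close to one. Such a rate
is classical when \<open>\<langle>\<Phi> h, h - m\<rangle> \<ge> c \<bar>h - m\<bar>^2\<close>, but \<open>\<Phi>\<close> is bounded, so this coercivity cannot hold on
the whole space. It does hold on every ball around \<open>m\<close>, with a constant depending on the ball
(\<open>grad_strongly_monotone\<close>), because the support of \<open>X\<close> contains three points that do not lie on a line
and no line through \<open>m\<close> is close to all three. A maximal inequality for the almost-supermartingale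
\<open>\<bar>T\<^sub>n\<bar>^2\<close> (\<open>prob_stays\<close>) confines the whole trajectory to a large ball with probability close to one,
and on the event of confinement the second moments satisfy the classical recursion
(\<open>second_moment_rate\<close>).
\<close>

section \<open>The field of unit vectors\<close>

lemma inner_sgn_self: "sgn y \<bullet> y = norm (y::'a::real_inner)"
  by (cases "y = 0") (simp_all add: sgn_div_norm power2_norm_eq_inner[symmetric] power2_eq_square)

text \<open>The norm is convex, and \<open>sgn y\<close> is a subgradient at \<open>y\<close>.\<close>
lemma norm_ge_tangent:
  fixes x y :: "'a::real_inner"
  shows "norm y + sgn y \<bullet> (x - y) \<le> norm x"
proof -
  have "sgn y \<bullet> x \<le> norm (sgn y) * norm x"
    by (rule norm_cauchy_schwarz)
  also have "\<dots> \<le> 1 * norm x"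
    by (intro mult_right_mono) (auto simp: norm_sgn)
  finally show ?thesis
    by (simp add: inner_diff_right inner_sgn_self)
qed

text \<open>
Only one of the two norms enters the bound: integrability of \<open>1 / \<bar>X - h\<bar>\<close> at a single \<open>h\<close> controls
the difference between the averaged field at \<open>h\<close> and at any other point.
\<close>
lemma norm_sgn_diff_le:
  fixes x y :: "'a::real_inner"
  assumes "x \<noteq> 0"
  shows "norm (sgn x - sgn y) \<le> 2 * norm (x - y) / norm x"
proof (cases "y = 0")
  case True
  with assms show ?thesis by (simp add: norm_sgn)
next
  case False
  have "sgn x - sgn y = (1 / norm x) *\<^sub>R (x - y) + (1 / norm x - 1 / norm y) *\<^sub>R y"
    by (simp add: sgn_div_norm algebra_simps inverse_eq_divide)
  also have "norm \<dots> \<le> norm ((1 / norm x) *\<^sub>R (x - y)) + norm ((1 / norm x - 1 / norm y) *\<^sub>R y)"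
    by (rule norm_triangle_ineq)
  also have "norm ((1 / norm x - 1 / norm y) *\<^sub>R y) = \<bar>norm y - norm x\<bar> / norm x"
  proof -
    have "(1 / norm x - 1 / norm y) * norm y = (norm y - norm x) / norm x"
      using assms False by (simp add: field_simps)
    thus ?thesis
      by (metis abs_div_pos abs_mult abs_norm_cancel assms norm_scaleR zero_less_norm_iff)
  qed
  also have "\<bar>norm y - norm x\<bar> \<le> norm (x - y)"
    using norm_triangle_ineq3[of x y] by linarith
  also have "norm ((1 / norm x) *\<^sub>R (x - y)) = norm (x - y) / norm x"
    by simp
  finally show ?thesis
    using assms by (simp add: divide_right_mono)
qed

text \<open>
Expanding, the left-hand side is \<open>(\<bar>x\<bar> \<bar>y\<bar> - \<langle>x, y\<rangle>) (\<bar>x\<bar> + \<bar>y\<bar>) / (\<bar>x\<bar> \<bar>y\<bar>)\<close>, and the first factor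
times \<open>\<bar>x\<bar> \<bar>y\<bar> + \<langle>x, y\<rangle> \<le> 2 \<bar>x\<bar> \<bar>y\<bar>\<close> is the Gram determinant of \<open>x\<close> and \<open>y\<close>. This determinant depends on \<open>x\<close> and \<open>x - y\<close> only through \<open>\<bar>x - y\<bar>\<close> and the distance from \<open>x\<close> to the line spanned by \<open>x - y\<close>, which
is how the geometry of the distribution enters.
\<close>
lemma sgn_diff_inner_ge:
  fixes x y :: "'a::real_inner"
  assumes "x \<noteq> 0" "y \<noteq> 0"
  shows "(sgn x - sgn y) \<bullet> (x - y)
    \<ge> ((norm x)\<^sup>2 * (norm y)\<^sup>2 - (x \<bullet> y)\<^sup>2) * (norm x + norm y) / (2 * (norm x)\<^sup>2 * (norm y)\<^sup>2)"
proof -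
  define a b c where "a = norm x" and "b = norm y" and "c = x \<bullet> y"
  have ab: "a > 0" "b > 0" using assms by (auto simp: a_def b_def)
  have c: "c \<le> a * b" "- (a * b) \<le> c"
    using Cauchy_Schwarz_ineq2[of x y] by (auto simp: a_def b_def c_def)
  have "sgn x \<bullet> y = c / a" "sgn y \<bullet> x = c / b"
    by (simp_all add: a_def b_def c_def sgn_div_norm inverse_eq_divide inner_commute)
  hence eq: "(sgn x - sgn y) \<bullet> (x - y) = (a * b - c) * (a + b) / (a * b)"
    using ab by (simp add: inner_diff_left inner_diff_right inner_sgn_self a_def[symmetric] b_def[symmetric] field_simps)
  have nn: "0 \<le> (a * b - c) * (a + b) / (a * b)"
    using ab c by simp
  have "(a\<^sup>2 * b\<^sup>2 - c\<^sup>2) * (a + b) / (2 * a\<^sup>2 * b\<^sup>2)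
      = (a * b + c) / (2 * (a * b)) * ((a * b - c) * (a + b) / (a * b))"
    using ab by (simp add: field_simps power2_eq_square)
  also have "\<dots> \<le> 1 * ((a * b - c) * (a + b) / (a * b))"
    using ab c nn by (intro mult_right_mono) (auto simp: divide_le_eq)
  finally show ?thesis
    unfolding eq by (simp add: a_def b_def c_def)
qed

lemma sgn_diff_inner_nonneg:
  fixes x y :: "'a::real_inner"
  shows "(sgn x - sgn y) \<bullet> (x - y) \<ge> 0"
  using norm_ge_tangent[of x y] norm_ge_tangent[of y x]
  by (simp add: inner_diff_left inner_diff_right inner_commute)

text \<open>
First order Taylor formula for the unit vector field at a unit vector, with a remainder that is
quadratic on the whole space, across the singularity. For \<open>\<bar>w\<bar> \<ge> 1/2\<close> every term is bounded by
\<open>2 + \<bar>w\<bar>\<close>. For \<open>\<bar>w\<bar> < 1/2\<close> the point \<open>e - w\<close> stays away from 0, and the first order terms cancel because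
\<open>s = \<bar>e - w\<bar>\<close> satisfies \<open>s^2 - 1 = \<bar>w\<bar>^2 - 2 \<langle>e, w\<rangle>\<close>.
\<close>
lemma sgn_expansion_unit:
  fixes e w :: "'a::real_inner"
  assumes "norm e = 1"
  shows "norm (e - sgn (e - w) - (w - (e \<bullet> w) *\<^sub>R e)) \<le> 10 * (norm w)\<^sup>2"
proof (cases "norm w \<ge> 1/2")
  case True
  have proj: "norm (w - (e \<bullet> w) *\<^sub>R e) \<le> norm w"
  proof (rule power2_le_imp_le)
    have "(norm (w - (e \<bullet> w) *\<^sub>R e))\<^sup>2 = (norm w)\<^sup>2 - (e \<bullet> w)\<^sup>2"
      using assms
      by (simp add: power2_norm_eq_inner inner_diff_left inner_diff_right norm_eq_1 inner_commute)
         (simp add: power2_eq_square)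
    thus "(norm (w - (e \<bullet> w) *\<^sub>R e))\<^sup>2 \<le> (norm w)\<^sup>2" by simp
  qed simp
  have "norm (e - sgn (e - w) - (w - (e \<bullet> w) *\<^sub>R e)) 
     \<le> norm e + norm (sgn (e - w)) + norm (w - (e \<bullet> w) *\<^sub>R e)"
    by (metis (no_types, lifting) add_mono_thms_linordered_semiring(3) norm_triangle_ineq4 order_trans)
  also have "\<dots> \<le> 1 + 1 + norm w"
    using proj assms by (auto simp: norm_sgn)
  also have "\<dots> \<le> 10 * (norm w)\<^sup>2"
  proof -
    have "(norm w - 1/2) * (10 * norm w + 4) \<ge> 0" using True by auto
    thus ?thesis by (simp add: algebra_simps power2_eq_square)
  qed
  finally show ?thesis .
next
  case False
  define s c t where "s = norm (e - w)" and "c = e \<bullet> w" and "t = norm w"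
  have t: "0 \<le> t" "t < 1/2" using False by (auto simp: t_def)
  have s1: "\<bar>s - 1\<bar> \<le> t"
    using norm_triangle_ineq3[of "e - w" e] assms by (simp add: s_def t_def)
  hence s: "s \<ge> 1/2" using t by auto
  have ct: "\<bar>c\<bar> \<le> t" using Cauchy_Schwarz_ineq2[of e w] assms by (simp add: c_def t_def)
  have s2: "s\<^sup>2 = 1 - 2 * c + t\<^sup>2"
    using assms by (simp add: s_def c_def t_def power2_norm_eq_inner inner_diff_left
       inner_diff_right inner_commute norm_eq_1)
  define p where "p = s * (s + 1)"
  have p: "p > 0" using s by (simp add: p_def)
  have ps: "1 - 1 / s = (t\<^sup>2 - 2 * c) / p"
  proof -
    have "(s - 1) * (s + 1) = t\<^sup>2 - 2 * c"
      using s2 by (simp add: algebra_simps power2_eq_square)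
    moreover have "1 - 1 / s = (s - 1) * (s + 1) / p"
    proof -
      have "s + 1 \<noteq> 0" "s \<noteq> 0" using s by auto
      thus ?thesis by (simp add: p_def diff_divide_distrib)
    qed
    ultimately show ?thesis by simp
  qed
  have "e - sgn (e - w) - (w - c *\<^sub>R e) = (1 - 1 / s) *\<^sub>R (e - w) + c *\<^sub>R e"
    by (simp add: sgn_div_norm s_def algebra_simps inverse_eq_divide)
  also have "\<dots> = (c * (1 - 2 / p)) *\<^sub>R e + (2 * c / p) *\<^sub>R w + (t\<^sup>2 / p) *\<^sub>R (e - w)"
    unfolding ps by (simp add: algebra_simps diff_divide_distrib)
  also have "norm \<dots> \<le> \<bar>c * (1 - 2 / p)\<bar> * norm e + \<bar>2 * c / p\<bar> * norm w + \<bar>t\<^sup>2 / p\<bar> * norm (e - w)"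
    by (intro order_trans[OF norm_triangle_ineq] add_mono) simp_all
  also have "\<bar>c * (1 - 2 / p)\<bar> * norm e \<le> 4 * t\<^sup>2"
  proof -
    have eq: "\<bar>1 - 2 / p\<bar> = \<bar>s - 1\<bar> * ((s + 2) / p)"
    proof -
      have "1 - 2 / p = (s - 1) * ((s + 2) / p)"
        using p by (simp add: p_def field_simps)
      thus ?thesis using p s by (simp add: abs_mult)
    qed
    have "(s + 2) / p \<le> 4"
    proof -
      have "0 \<le> (s - 1/2) * (4 * s + 5)" using s by (intro mult_nonneg_nonneg) auto
      hence "s + 2 \<le> 4 * p" by (simp add: p_def algebra_simps)
      thus ?thesis using p by (simp add: field_simps)
    qed
    hence "\<bar>1 - 2 / p\<bar> \<le> t * 4"
      unfolding eq using s1 p s t by (intro mult_mono) auto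
    hence "\<bar>c\<bar> * \<bar>1 - 2 / p\<bar> \<le> t * (t * 4)"
      using ct t by (intro mult_mono) auto
    thus ?thesis using assms by (simp add: abs_mult power2_eq_square)
  qed
  also have "\<bar>2 * c / p\<bar> * norm w \<le> 4 * t\<^sup>2"
  proof -
    have "s * (s + 1) \<ge> 1/2 * (1/2 + 1)" using s by (intro mult_mono) auto
    hence "1 / p \<le> 2" using p by (simp add: p_def field_simps)
    hence "\<bar>c\<bar> * (1 / p) \<le> t * 2" using ct t p by (intro mult_mono) auto
    hence "2 * (\<bar>c\<bar> * (1 / p)) * t \<le> 2 * (t * 2) * t" using t by (intro mult_right_mono) auto
    thus ?thesis using p by (simp add: abs_mult t_def power2_eq_square)
  qed
  also have "\<bar>t\<^sup>2 / p\<bar> * norm (e - w) \<le> t\<^sup>2"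
  proof -
    have "\<bar>t\<^sup>2 / p\<bar> * norm (e - w) = t\<^sup>2 / (s + 1)"
      using s by (simp add: s_def[symmetric] p_def)
    also have "\<dots> \<le> t\<^sup>2 / 1" using s by (intro divide_left_mono) auto
    finally show ?thesis by simp
  qed
  finally have "norm (e - sgn (e - w) - (w - (e \<bullet> w) *\<^sub>R e)) \<le> 9 * (norm w)\<^sup>2"
    by (simp add: c_def t_def)
  thus ?thesis using zero_le_power2[of "norm w"] by linarith
qed

text \<open>The unit vector field is homogeneous of degree 0, so scaling reduces this to unit vectors.\<close>
lemma sgn_expansion:
  fixes x w :: "'a::real_inner"
  assumes "x \<noteq> 0"
  shows "norm (sgn x - sgn (x - w) - (1 / norm x) *\<^sub>R (w - (1 / (norm x)\<^sup>2) *\<^sub>R ((x \<bullet> w) *\<^sub>R x)))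
    \<le> 10 * (norm w)\<^sup>2 * (1 / (norm x)\<^sup>2)"
proof -
  define r where "r = norm x"
  have r: "r > 0" using assms by (simp add: r_def)
  have e: "norm (sgn x) = 1" using assms by (simp add: norm_sgn)
  have xs: "x = r *\<^sub>R sgn x" using assms by (simp add: r_def sgn_div_norm)
  have "sgn (x - w) = sgn ((1 / r) *\<^sub>R (x - w))"
    using r by (simp add: sgn_scaleR)
  also have "(1 / r) *\<^sub>R (x - w) = sgn x - (1 / r) *\<^sub>R w"
    by (simp add: sgn_div_norm r_def scaleR_diff_right inverse_eq_divide)
  finally have 1: "sgn (x - w) = sgn (sgn x - (1 / r) *\<^sub>R w)" .
  have 2: "(1 / r) *\<^sub>R (w - (1 / r\<^sup>2) *\<^sub>R ((x \<bullet> w) *\<^sub>R x))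
     = (1 / r) *\<^sub>R w - (sgn x \<bullet> ((1 / r) *\<^sub>R w)) *\<^sub>R sgn x"
    by (simp add: sgn_div_norm r_def[symmetric] scaleR_diff_right inverse_eq_divide
       power2_eq_square)
  show ?thesis
    using sgn_expansion_unit[OF e, of "(1 / r) *\<^sub>R w"]
    unfolding r_def[symmetric] 1 2 using r by (simp add: power_divide)
qed

section \<open>Random vectors that are not carried by a line\<close>

definition support :: "'w measure \<Rightarrow> ('w \<Rightarrow> 'a::metric_space) \<Rightarrow> 'a set" where
  "support M X = {p. \<forall>r>0. measure M {\<omega> \<in> space M. X \<omega> \<in> ball p r} > 0}"

text \<open>
By second countability the complement of the support is a countable union of open null sets.
\<close>
lemma (in prob_space) AE_in_support:
  fixes X :: "'a \<Rightarrow> 'b::{metric_space, second_countable_topology}"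
  assumes [measurable]: "X \<in> borel_measurable M"
  shows "AE \<omega> in M. X \<omega> \<in> support M X"
proof -
  define N where "N = {B. open B \<and> prob {\<omega> \<in> space M. X \<omega> \<in> B} = 0}"
  obtain N' where N': "N' \<subseteq> N" "countable N'" "\<Union>N' = \<Union>N"
    using Lindelof[of N] by (auto simp: N_def)
  have "AE \<omega> in M. \<forall>B\<in>N'. X \<omega> \<notin> B"
  proof (subst AE_ball_countable[OF N'(2)], intro ballI)
    fix B assume "B \<in> N'"
    hence B: "open B" "prob {\<omega> \<in> space M. X \<omega> \<in> B} = 0" using N'(1) by (auto simp: N_def)
    from B(1) have [measurable]: "B \<in> sets borel" by auto
    have "{\<omega> \<in> space M. X \<omega> \<in> B} \<in> null_sets M"
      using B(2) by (intro null_setsI) (auto simp: emeasure_eq_measure)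
    thus "AE \<omega> in M. X \<omega> \<notin> B" by (rule AE_I'[of _ M]) auto
  qed
  moreover have "p \<in> \<Union>N'" if "p \<notin> support M X" for p
  proof -
    from that obtain r where "r > 0" "prob {\<omega> \<in> space M. X \<omega> \<in> ball p r} = 0"
      by (auto simp: support_def zero_less_measure_iff)
    hence "ball p r \<in> N" "p \<in> ball p r" by (auto simp: N_def)
    thus ?thesis unfolding N'(3) by blast
  qed
  ultimately show ?thesis by (auto elim!: eventually_mono)
qed

lemma (in prob_space) ext_variance_AE_const:
  assumes [measurable]: "Y \<in> borel_measurable M" and ae: "AE \<omega> in M. Y \<omega> = c"
  shows "ext_variance M Y = 0"
proof -
  have "expectation Y = expectation (\<lambda>_. c)"
    using ae by (intro integral_cong_AE) auto
  hence "expectation Y = c" by (simp add: prob_space)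
  hence "ext_variance M Y = (\<integral>\<^sup>+\<omega>. 0 \<partial>M)"
    unfolding ext_variance_def using ae by (intro nn_integral_cong_AE) auto
  thus ?thesis by simp
qed

text \<open>
Otherwise \<open>X\<close> lives almost surely on a line with some direction \<open>d\<close>, and then \<open>\<langle>h', X\<rangle>\<close> is almost surely
constant for every \<open>h'\<close> orthogonal to \<open>d\<close>. Non-collinearity is expressed by the strict Cauchy-Schwarz
inequality for two edges of the triangle.
\<close>
lemma not_collinear_support:
  fixes X :: "'w \<Rightarrow> 'a::{real_inner, second_countable_topology}"
  assumes "prob_space M" and [measurable]: "X \<in> borel_measurable M"
    and nd: "\<And>h. \<exists>h'. h \<bullet> h' = 0 \<and> ext_variance M (\<lambda>\<omega>. h' \<bullet> X \<omega>) > 0"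
  obtains p0 p1 p2 where "p0 \<in> support M X" "p1 \<in> support M X" "p2 \<in> support M X"
    "((p1 - p0) \<bullet> (p2 - p0))\<^sup>2 < (norm (p1 - p0))\<^sup>2 * (norm (p2 - p0))\<^sup>2"
proof -
  interpret prob_space M by fact
  have ae: "AE \<omega> in M. X \<omega> \<in> support M X" by (rule AE_in_support) simp
  have no_line: False if "support M X \<subseteq> {p0 + t *\<^sub>R d | t. True}" for p0 d
  proof -
    obtain h' where h': "d \<bullet> h' = 0" "ext_variance M (\<lambda>\<omega>. h' \<bullet> X \<omega>) > 0" using nd by blast
    have "AE \<omega> in M. h' \<bullet> X \<omega> = h' \<bullet> p0"
      using ae by eventually_elim
        (use that h'(1) in \<open>auto simp: inner_add_right inner_commute\<close>)
    from ext_variance_AE_const[OF _ this] h'(2) show False by simp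
  qed
  obtain p0 where p0: "p0 \<in> support M X" using no_line by fastforce
  obtain p1 where p1: "p1 \<in> support M X" "p1 \<noteq> p0"
    using no_line[of p0 0] by fastforce
  define d where "d = p1 - p0"
  obtain p2 where p2: "p2 \<in> support M X" "\<And>t. p2 \<noteq> p0 + t *\<^sub>R d"
    using no_line[of p0 d] by blast
  have "(d \<bullet> (p2 - p0))\<^sup>2 \<noteq> (norm d)\<^sup>2 * (norm (p2 - p0))\<^sup>2"
  proof
    assume eq: "(d \<bullet> (p2 - p0))\<^sup>2 = (norm d)\<^sup>2 * (norm (p2 - p0))\<^sup>2"
    define t where "t = (d \<bullet> (p2 - p0)) / (norm d)\<^sup>2"
    have d: "(norm d)\<^sup>2 > 0" using p1 by (simp add: d_def)
    have "(norm ((p2 - p0) - t *\<^sub>R d))\<^sup>2 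
       = (norm (p2 - p0))\<^sup>2 - 2 * t * (d \<bullet> (p2 - p0)) + t\<^sup>2 * (norm d)\<^sup>2"
      unfolding power2_norm_eq_inner inner_diff_left[of "p2 - p0"] inner_diff_right[of _ "p2 - p0"]
      by (simp add: inner_commute power2_eq_square algebra_simps)
    also have "t\<^sup>2 * (norm d)\<^sup>2 = t * (d \<bullet> (p2 - p0))"
      using d by (simp add: t_def power2_eq_square)
    also have "(norm (p2 - p0))\<^sup>2 = t * (d \<bullet> (p2 - p0))"
    proof -
      have "t * (d \<bullet> (p2 - p0)) = (d \<bullet> (p2 - p0))\<^sup>2 / (norm d)\<^sup>2"
        by (simp add: t_def power2_eq_square)
      also have "\<dots> = (norm (p2 - p0))\<^sup>2"
        unfolding eq using d by simp
      finally show ?thesis by simp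
    qed
    finally have "p2 - p0 = t *\<^sub>R d" by simp
    hence "p2 = p0 + t *\<^sub>R d" by (metis add.commute diff_add_cancel)
    with p2(2) show False by blast
  qed
  moreover have "(d \<bullet> (p2 - p0))\<^sup>2 \<le> (norm d)\<^sup>2 * (norm (p2 - p0))\<^sup>2"
    using Cauchy_Schwarz_ineq[of d "p2 - p0"] by (simp add: power2_norm_eq_inner)
  ultimately show ?thesis
    using that[OF p0 p1(1) p2(1)] by (simp add: d_def)
qed

definition orth_part :: "'a::real_inner \<Rightarrow> 'a \<Rightarrow> 'a" where "orth_part u x = x - (x \<bullet> u) *\<^sub>R u"

lemma norm_orth_part_le: "norm u = 1 \<Longrightarrow> norm (orth_part u x) \<le> norm x"
  by (rule power2_le_imp_le) (auto simp: orth_part_def power2_norm_eq_inner inner_diff_left inner_diff_right norm_eq_1 inner_commute)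

lemma orth_part_diff: "orth_part u (x - y) = orth_part u x - orth_part u y"
  by (simp add: orth_part_def inner_diff_left scaleR_diff_left)

lemma gram_orth_part:
  fixes x u :: "'a::real_inner"
  assumes "norm u = 1"
  shows "(norm x)\<^sup>2 * (norm (s *\<^sub>R u))\<^sup>2 - (x \<bullet> (s *\<^sub>R u))\<^sup>2 = s\<^sup>2 * (norm (orth_part u x))\<^sup>2"
proof -
  have "(norm (orth_part u x))\<^sup>2 = (norm x)\<^sup>2 - (x \<bullet> u)\<^sup>2"
    using assms
    by (simp add: orth_part_def power2_norm_eq_inner inner_diff_left inner_diff_right norm_eq_1 inner_commute)
       (simp add: power2_eq_square)
  hence "(norm x)\<^sup>2 = (norm (orth_part u x))\<^sup>2 + (x \<bullet> u)\<^sup>2" by simp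
  thus ?thesis using assms by (simp add: power_mult_distrib distrib_left mult.commute)
qed

text \<open>
Two vectors close to a common line span a thin parallelogram; its squared area is the Gram
determinant.
\<close>
lemma gram_le_orth_part:
  fixes x y u :: "'a::real_inner"
  assumes u: "norm u = 1" and "norm (orth_part u x) \<le> e" "norm (orth_part u y) \<le> e"
  shows "(norm x)\<^sup>2 * (norm y)\<^sup>2 - (x \<bullet> y)\<^sup>2 \<le> ((norm x + norm y)\<^sup>2 + (norm x)\<^sup>2) * e\<^sup>2"
proof -
  define a b p q k where "a = x \<bullet> u" and "b = y \<bullet> u" and "p = norm (orth_part u x)" 
    and "q = norm (orth_part u y)" and "k = orth_part u x \<bullet> orth_part u y"
  have X: "(norm x)\<^sup>2 = a\<^sup>2 + p\<^sup>2" and Y: "(norm y)\<^sup>2 = b\<^sup>2 + q\<^sup>2" and XY: "x \<bullet> y = a * b + k"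
    using u by (simp_all add: orth_part_def p_def q_def k_def a_def b_def power2_norm_eq_inner inner_diff_left inner_diff_right norm_eq_1 inner_commute)
       (simp_all add: power2_eq_square)
  have ab: "\<bar>a\<bar> \<le> norm x" "\<bar>b\<bar> \<le> norm y"
    using Cauchy_Schwarz_ineq2[of x u] Cauchy_Schwarz_ineq2[of y u] u by (auto simp: a_def b_def)
  have pq: "0 \<le> p" "0 \<le> q" "p \<le> e" "q \<le> e" "p \<le> norm x"
    using assms norm_orth_part_le[OF u] by (auto simp: p_def q_def)
  have k: "\<bar>k\<bar> \<le> p * q" unfolding k_def p_def q_def by (rule Cauchy_Schwarz_ineq2)
  have "(norm x)\<^sup>2 * (norm y)\<^sup>2 - (x \<bullet> y)\<^sup>2 = a\<^sup>2 * q\<^sup>2 + b\<^sup>2 * p\<^sup>2 + p\<^sup>2 * q\<^sup>2 - 2 * (a * b * k) - k\<^sup>2"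
    unfolding X Y XY by (simp add: power2_eq_square algebra_simps)
  also have "\<dots> \<le> a\<^sup>2 * q\<^sup>2 + b\<^sup>2 * p\<^sup>2 + p\<^sup>2 * q\<^sup>2 + 2 * (\<bar>a\<bar> * \<bar>b\<bar> * (p * q))"
  proof -
    have "- (a * b * k) \<le> \<bar>a\<bar> * \<bar>b\<bar> * \<bar>k\<bar>" by (metis abs_ge_minus_self abs_mult)
    also have "\<dots> \<le> \<bar>a\<bar> * \<bar>b\<bar> * (p * q)" using k by (intro mult_left_mono) auto
    finally show ?thesis using zero_le_power2[of k] by linarith
  qed
  also have "\<dots> = (\<bar>a\<bar> * q + \<bar>b\<bar> * p)\<^sup>2 + p\<^sup>2 * q\<^sup>2"
    by (simp add: power2_eq_square algebra_simps)
  also have "\<dots> \<le> (norm x * e + norm y * e)\<^sup>2 + (norm x)\<^sup>2 * e\<^sup>2"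
    using ab pq by (intro add_mono power_mono mult_mono) auto
  finally show ?thesis by (simp add: power2_eq_square algebra_simps)
qed

text \<open>
The bound is uniform over all lines. Compactness of the unit sphere would give such uniformity in
finite dimension only; here it comes from the area of the triangle: three points close to one line
span a triangle of small area.
\<close>
lemma triangle_far_from_line:
  fixes p0 p1 p2 :: "'a::real_inner"
  assumes "((p1 - p0) \<bullet> (p2 - p0))\<^sup>2 < (norm (p1 - p0))\<^sup>2 * (norm (p2 - p0))\<^sup>2"
  shows "\<exists>\<eta>>0. \<forall>u c. norm u = 1 \<longrightarrow> (\<exists>p\<in>{p0,p1,p2}. norm (orth_part u (p - c)) \<ge> \<eta>)"
proof -
  define x y where "x = p1 - p0" and "y = p2 - p0"
  define K where "K = (norm x + norm y)\<^sup>2 + (norm x)\<^sup>2"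
  define G where "G = (norm x)\<^sup>2 * (norm y)\<^sup>2 - (x \<bullet> y)\<^sup>2"
  have G: "G > 0" using assms by (simp add: G_def x_def y_def)
  have "K \<ge> 0" by (simp add: K_def)
  \<comment> \<open>if all three points are within \<open>\<eta>\<close> of the line, then the edges deviate from its direction by at most \<open>2 \<eta>\<close>,
    which forces \<open>G \<le> K (2 \<eta>)^2 < G\<close>\<close>
  define \<eta> where "\<eta> = sqrt (G / (K + 1)) / 2"
  have eta: "\<eta> > 0" using G \<open>K \<ge> 0\<close> by (simp add: \<eta>_def)
  show ?thesis
  proof (intro exI[of _ \<eta>] conjI eta allI impI, rule ccontr)
    fix u c :: 'a
    assume u: "norm u = 1" and "\<not> (\<exists>p\<in>{p0,p1,p2}. norm (orth_part u (p - c)) \<ge> \<eta>)"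
    hence *: "norm (orth_part u (p0 - c)) < \<eta>" "norm (orth_part u (p1 - c)) < \<eta>" "norm (orth_part u (p2 - c)) < \<eta>"
      by auto
    have "norm (orth_part u x) \<le> 2 * \<eta>"
      using * norm_triangle_ineq4[of "orth_part u (p1 - c)" "orth_part u (p0 - c)"] by (simp add: x_def orth_part_diff)
    moreover have "norm (orth_part u y) \<le> 2 * \<eta>"
      using * norm_triangle_ineq4[of "orth_part u (p2 - c)" "orth_part u (p0 - c)"] by (simp add: y_def orth_part_diff)
    ultimately have "G \<le> K * (2 * \<eta>)\<^sup>2"
      unfolding G_def K_def by (rule gram_le_orth_part[OF u])
    also have "\<dots> = K * (G / (K + 1))"
      using G \<open>K \<ge> 0\<close> by (simp add: \<eta>_def)
    also have "\<dots> < G" using G \<open>K \<ge> 0\<close> by (simp add: field_simps)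
    finally show False by simp
  qed
qed

section \<open>The gradient of the median objective\<close>

locale hilbert_median = prob_space M for M :: "'w measure" +
  fixes X :: "'w \<Rightarrow> 'a::{real_inner, banach, second_countable_topology}"
    and C :: real and m :: 'a
  assumes X_meas [measurable]: "X \<in> borel_measurable M"
    and C_pos: "C > 0"
    and inverse_moment: "\<And>h. (\<integral>\<^sup>+\<omega>. inverse (ennreal (norm (X \<omega> - h))) \<partial>M) \<le> ennreal C"
    and inverse_moment_2: "\<And>h. (\<integral>\<^sup>+\<omega>. inverse ((ennreal (norm (X \<omega> - h)))\<^sup>2) \<partial>M) \<le> ennreal C"
    and nondegenerate: "\<And>h. \<exists>h'. h \<bullet> h' = 0 \<and> ext_variance M (\<lambda>\<omega>. h' \<bullet> X \<omega>) > 0"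
    and median: "is_geometric_median M X m"
begin

lemma AE_X_neq: "AE \<omega> in M. X \<omega> \<noteq> h"
proof -
  have "AE \<omega> in M. inverse (ennreal (norm (X \<omega> - h))) \<noteq> \<infinity>"
    using inverse_moment[of h] by (intro nn_integral_PInf_AE) (auto simp: top_unique)
  thus ?thesis by eventually_elim auto
qed

lemma integrable_of_inverse_moment:
  fixes f :: "'w \<Rightarrow> real"
  assumes [measurable]: "f \<in> borel_measurable M" and nn: "\<And>\<omega>. f \<omega> \<ge> 0"
    and le: "(\<integral>\<^sup>+\<omega>. g \<omega> \<partial>M) \<le> ennreal C" and eq: "AE \<omega> in M. g \<omega> = ennreal (f \<omega>)"
  shows "integrable M f" "expectation f \<le> C"
proof -
  have *: "(\<integral>\<^sup>+\<omega>. ennreal (f \<omega>) \<partial>M) \<le> ennreal C"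
    using le nn_integral_cong_AE[OF eq] by simp
  show i: "integrable M f"
    using * nn by (intro integrableI_nonneg) (auto intro: le_less_trans)
  have "ennreal (expectation f) \<le> ennreal C"
    using * nn_integral_eq_integral[OF i] nn by simp
  thus "expectation f \<le> C" using C_pos by (simp add: ennreal_le_iff)
qed

lemma inverse_norm:
  "integrable M (\<lambda>\<omega>. 1 / norm (X \<omega> - h))" "expectation (\<lambda>\<omega>. 1 / norm (X \<omega> - h)) \<le> C"
proof -
  have "AE \<omega> in M. inverse (ennreal (norm (X \<omega> - h))) = ennreal (1 / norm (X \<omega> - h))"
    using AE_X_neq[of h] by eventually_elim (simp add: inverse_ennreal inverse_eq_divide)
  from integrable_of_inverse_moment[OF _ _ inverse_moment this]
  show "integrable M (\<lambda>\<omega>. 1 / norm (X \<omega> - h))" "expectation (\<lambda>\<omega>. 1 / norm (X \<omega> - h)) \<le> C"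
    by auto
qed

lemma inverse_norm_2:
  "integrable M (\<lambda>\<omega>. 1 / (norm (X \<omega> - h))\<^sup>2)" "expectation (\<lambda>\<omega>. 1 / (norm (X \<omega> - h))\<^sup>2) \<le> C"
proof -
  have "AE \<omega> in M. inverse ((ennreal (norm (X \<omega> - h)))\<^sup>2) = ennreal (1 / (norm (X \<omega> - h))\<^sup>2)"
    using AE_X_neq[of h]
    by eventually_elim (simp add: inverse_ennreal inverse_eq_divide ennreal_power)
  from integrable_of_inverse_moment[OF _ _ inverse_moment_2 this]
  show "integrable M (\<lambda>\<omega>. 1 / (norm (X \<omega> - h))\<^sup>2)" "expectation (\<lambda>\<omega>. 1 / (norm (X \<omega> - h))\<^sup>2) \<le> C"
    by auto
qed

lemma sgn_measurable [measurable (raw)]: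
  "f \<in> borel_measurable N \<Longrightarrow> (\<lambda>\<omega>. sgn (f \<omega> :: 'a)) \<in> borel_measurable N"
  unfolding sgn_div_norm by measurable

lemma integrable_sgn [simp]: "integrable M (\<lambda>\<omega>. sgn (X \<omega> - h))"
  by (rule integrable_const_bound[of _ 1]) (auto simp: norm_sgn)

text \<open>
The gradient of the median objective, with the differentiation carried out under the expectation.
\<close>
definition grad :: "'a \<Rightarrow> 'a" where "grad h = - expectation (\<lambda>\<omega>. sgn (X \<omega> - h))"

lemma norm_grad_le: "norm (grad h) \<le> 1"
proof -
  have "norm (grad h) \<le> expectation (\<lambda>\<omega>. norm (sgn (X \<omega> - h)))"
    unfolding grad_def norm_minus_cancel by (rule integral_norm_bound)
  also have "\<dots> \<le> expectation (\<lambda>_. 1)"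
    by (intro integral_mono integrable_norm) (simp_all, simp add: norm_sgn)
  finally show ?thesis by (simp add: prob_space)
qed

lemma grad_diff: "grad h - grad k = expectation (\<lambda>\<omega>. sgn (X \<omega> - k) - sgn (X \<omega> - h))"
  by (simp add: grad_def)

lemma grad_lipschitz: "norm (grad h - grad k) \<le> 2 * C * norm (h - k)"
proof -
  have "norm (grad h - grad k) \<le> expectation (\<lambda>\<omega>. norm (sgn (X \<omega> - k) - sgn (X \<omega> - h)))"
    unfolding grad_diff by (rule integral_norm_bound)
  also have "\<dots> \<le> expectation (\<lambda>\<omega>. 2 * norm (h - k) * (1 / norm (X \<omega> - k)))"
  proof (rule integral_mono_AE)
    show "integrable M (\<lambda>\<omega>. 2 * norm (h - k) * (1 / norm (X \<omega> - k)))"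
      using inverse_norm by (intro integrable_mult_right) auto
    show "AE \<omega> in M. norm (sgn (X \<omega> - k) - sgn (X \<omega> - h)) \<le> 2 * norm (h - k) * (1 / norm (X \<omega> - k))"
      using AE_X_neq[of k]
    proof eventually_elim
      case (elim \<omega>)
      thus ?case using norm_sgn_diff_le[of "X \<omega> - k" "X \<omega> - h"] by simp
    qed
  qed auto
  also have "\<dots> = 2 * norm (h - k) * expectation (\<lambda>\<omega>. 1 / norm (X \<omega> - k))"
    by (rule integral_mult_right_zero)
  also have "\<dots> \<le> 2 * norm (h - k) * C"
    using inverse_norm by (intro mult_left_mono) auto
  finally show ?thesis by (simp add: mult_ac)
qed

lemma continuous_grad: "continuous_on UNIV grad"
proof -
  have "(2 * C)-lipschitz_on UNIV grad"
    using grad_lipschitz C_pos by (intro lipschitz_onI) (auto simp: dist_norm)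
  thus ?thesis by (rule lipschitz_on_continuous_on)
qed

lemma grad_measurable [measurable]: "grad \<in> borel_measurable borel"
  by (rule borel_measurable_continuous_onI[OF continuous_grad])

lemma integrable_norm_diff: "integrable M (\<lambda>\<omega>. norm (X \<omega> - h) - norm (X \<omega>))"
proof (rule integrable_const_bound)
  show "AE \<omega> in M. norm (norm (X \<omega> - h) - norm (X \<omega>)) \<le> norm h"
  proof (rule AE_I2)
    fix \<omega> show "norm (norm (X \<omega> - h) - norm (X \<omega>)) \<le> norm h"
      using norm_triangle_ineq3[of "X \<omega> - h" "X \<omega>"] by simp
  qed
qed measurable

text \<open>
The subgradient inequality for the norm replaces a differentiation under the integral: minimality of
\<open>m\<close> gives \<open>\<langle>grad (m + t v), v\<rangle> \<ge> 0\<close> for every \<open>t > 0\<close>, and continuity of the gradient lets \<open>t\<close> tend to 0.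
Taking \<open>v = - grad m\<close> finishes the proof.
\<close>
lemma grad_median: "grad m = 0"
proof -
  have pos: "grad (m + t *\<^sub>R v) \<bullet> v \<ge> 0" if t: "t > 0" for t v
  proof -
    define h where "h = m + t *\<^sub>R v"
    have "median_objective M X m \<le> median_objective M X h"
      using median by (simp add: is_geometric_median_def is_arg_min_linorder)
    hence "0 \<le> expectation (\<lambda>\<omega>. (norm (X \<omega> - h) - norm (X \<omega>)) - (norm (X \<omega> - m) - norm (X \<omega>)))"
      by (subst Bochner_Integration.integral_diff[OF integrable_norm_diff integrable_norm_diff])
         (simp add: median_objective_def)
    also have "\<dots> \<le> expectation (\<lambda>\<omega>. - t * (sgn (X \<omega> - h) \<bullet> v))"
    proof (rule integral_mono)
      show "integrable M (\<lambda>\<omega>. norm (X \<omega> - h) - norm (X \<omega>) - (norm (X \<omega> - m) - norm (X \<omega>)))"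
        by (intro Bochner_Integration.integrable_diff integrable_norm_diff)
      show "norm (X \<omega> - h) - norm (X \<omega>) - (norm (X \<omega> - m) - norm (X \<omega>))
          \<le> - t * (sgn (X \<omega> - h) \<bullet> v)" for \<omega>
        using norm_ge_tangent[of "X \<omega> - h" "X \<omega> - m"] by (simp add: h_def)
    qed auto
    also have "\<dots> = t * (grad h \<bullet> v)"
      by (simp add: grad_def)
    finally show ?thesis using t by (simp add: h_def zero_le_mult_iff)
  qed
  have "grad m \<bullet> v \<ge> 0" for v
  proof (rule tendsto_lowerbound)
    show "((\<lambda>t. grad (m + t *\<^sub>R v) \<bullet> v) \<longlongrightarrow> grad m \<bullet> v) (at_right 0)"
    proof -
      have "((\<lambda>t. m + t *\<^sub>R v) \<longlongrightarrow> m + 0 *\<^sub>R v) (at_right 0)"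
        by (intro tendsto_intros)
      hence "((\<lambda>t. grad (m + t *\<^sub>R v)) \<longlongrightarrow> grad m) (at_right 0)"
        by (intro continuous_on_tendsto_compose[OF continuous_grad]) auto
      thus ?thesis by (intro tendsto_intros)
    qed
    show "\<forall>\<^sub>F t in at_right 0. 0 \<le> grad (m + t *\<^sub>R v) \<bullet> v"
      unfolding eventually_at_right_field by (intro exI[of _ 1] conjI allI impI pos zero_less_one)
  qed auto
  from this[of "- grad m"] show ?thesis
    by (metis inner_eq_zero_iff inner_ge_zero inner_minus_right neg_0_le_iff_le order_antisym)
qed

abbreviation Gamma_integrand :: "'a \<Rightarrow> 'w \<Rightarrow> 'a" where
  "Gamma_integrand h \<omega> \<equiv> (1 / norm (X \<omega> - m)) *\<^sub>R
     (h - (1 / (norm (X \<omega> - m))\<^sup>2) *\<^sub>R (((X \<omega> - m) \<bullet> h) *\<^sub>R (X \<omega> - m)))"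

lemma Gamma_op_eq: "Gamma_op M X m h = expectation (Gamma_integrand h)"
  by (simp add: Gamma_op_def op_expectation_def tensor_op_def)

lemma norm_Gamma_integrand_le: "norm (Gamma_integrand h \<omega>) \<le> 2 * norm h * (1 / norm (X \<omega> - m))"
proof -
  define x where "x = X \<omega> - m"
  have "norm ((1 / (norm x)\<^sup>2) *\<^sub>R ((x \<bullet> h) *\<^sub>R x)) \<le> norm h"
  proof (cases "x = 0")
    case False
    have "norm ((1 / (norm x)\<^sup>2) *\<^sub>R ((x \<bullet> h) *\<^sub>R x)) = \<bar>x \<bullet> h\<bar> / norm x"
      using False by (simp add: power2_eq_square)
    also have "\<dots> \<le> norm x * norm h / norm x"
      using Cauchy_Schwarz_ineq2[of x h] by (intro divide_right_mono) auto
    finally show ?thesis using False by simp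
  qed simp
  hence "norm (h - (1 / (norm x)\<^sup>2) *\<^sub>R ((x \<bullet> h) *\<^sub>R x)) \<le> 2 * norm h"
    using norm_triangle_ineq4[of h "(1 / (norm x)\<^sup>2) *\<^sub>R ((x \<bullet> h) *\<^sub>R x)"] by linarith
  thus ?thesis unfolding x_def[symmetric] by (simp add: divide_right_mono)
qed

lemma integrable_Gamma_integrand: "integrable M (Gamma_integrand h)"
proof (rule Bochner_Integration.integrable_bound)
  show "integrable M (\<lambda>\<omega>. 2 * norm h * (1 / norm (X \<omega> - m)))"
    using inverse_norm by (intro integrable_mult_right) auto
  show "AE \<omega> in M. norm (Gamma_integrand h \<omega>) \<le> norm (2 * norm h * (1 / norm (X \<omega> - m)))"
    using norm_Gamma_integrand_le[of _ h] by (intro AE_I2) simp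
qed measurable

lemma bounded_linear_Gamma: "bounded_linear (Gamma_op M X m)"
proof (rule bounded_linear_intro[of _ "2 * C"])
  fix h k :: 'a and r :: real
  have "Gamma_op M X m (h + k) = expectation (\<lambda>\<omega>. Gamma_integrand h \<omega> + Gamma_integrand k \<omega>)"
    unfolding Gamma_op_eq by (intro Bochner_Integration.integral_cong) (auto simp: algebra_simps)
  also have "\<dots> = Gamma_op M X m h + Gamma_op M X m k"
    unfolding Gamma_op_eq
    by (rule Bochner_Integration.integral_add[OF integrable_Gamma_integrand integrable_Gamma_integrand])
  finally show "Gamma_op M X m (h + k) = Gamma_op M X m h + Gamma_op M X m k" .
  have "Gamma_op M X m (r *\<^sub>R h) = expectation (\<lambda>\<omega>. r *\<^sub>R Gamma_integrand h \<omega>)"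
    unfolding Gamma_op_eq by (intro Bochner_Integration.integral_cong) (auto simp: algebra_simps)
  also have "\<dots> = r *\<^sub>R Gamma_op M X m h"
    unfolding Gamma_op_eq by (rule integral_scaleR_right)
  finally show "Gamma_op M X m (r *\<^sub>R h) = r *\<^sub>R Gamma_op M X m h" .
  have "norm (Gamma_op M X m h) \<le> expectation (\<lambda>\<omega>. norm (Gamma_integrand h \<omega>))"
    unfolding Gamma_op_eq by (rule integral_norm_bound)
  also have "\<dots> \<le> expectation (\<lambda>\<omega>. 2 * norm h * (1 / norm (X \<omega> - m)))"
    using integrable_Gamma_integrand inverse_norm(1) norm_Gamma_integrand_le
    by (intro integral_mono integrable_norm integrable_mult_right) auto
  also have "\<dots> = 2 * norm h * expectation (\<lambda>\<omega>. 1 / norm (X \<omega> - m))"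
    by (rule integral_mult_right_zero)
  also have "\<dots> \<le> 2 * norm h * C"
    using inverse_norm by (intro mult_left_mono) auto
  finally show "norm (Gamma_op M X m h) \<le> norm h * (2 * C)" by simp
qed

text \<open>
The pointwise Taylor remainder is at most \<open>10 \<bar>w\<bar>^2 / \<bar>X - m\<bar>^2\<close>, which has expectation at most
\<open>10 C \<bar>w\<bar>^2\<close>.
\<close>
lemma grad_taylor: "norm (grad (m + w) - Gamma_op M X m w) \<le> 10 * C * (norm w)\<^sup>2"
proof -
  have *: "grad (m + w) - Gamma_op M X m w
      = expectation (\<lambda>\<omega>. sgn (X \<omega> - m) - sgn (X \<omega> - (m + w)) - Gamma_integrand w \<omega>)"
  proof -
    have "expectation (\<lambda>\<omega>. sgn (X \<omega> - m) - sgn (X \<omega> - (m + w)) - Gamma_integrand w \<omega>)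
        = expectation (\<lambda>\<omega>. sgn (X \<omega> - m) - sgn (X \<omega> - (m + w))) - expectation (Gamma_integrand w)"
      by (intro Bochner_Integration.integral_diff integrable_Gamma_integrand
          Bochner_Integration.integrable_diff integrable_sgn)
    thus ?thesis using grad_diff[of "m + w" m] by (simp only: grad_median Gamma_op_eq diff_zero)
  qed
  have "norm (grad (m + w) - Gamma_op M X m w) \<le> expectation (\<lambda>\<omega>. norm (sgn (X \<omega> - m) - sgn (X \<omega> - (m + w)) - Gamma_integrand w \<omega>))"
    unfolding * by (rule integral_norm_bound)
  also have "\<dots> \<le> expectation (\<lambda>\<omega>. 10 * (norm w)\<^sup>2 * (1 / (norm (X \<omega> - m))\<^sup>2))"
  proof (rule integral_mono_AE)
    show "integrable M (\<lambda>\<omega>. 10 * (norm w)\<^sup>2 * (1 / (norm (X \<omega> - m))\<^sup>2))"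
      using inverse_norm_2 by (intro integrable_mult_right) auto
    show "integrable M (\<lambda>\<omega>. norm (sgn (X \<omega> - m) - sgn (X \<omega> - (m + w)) - Gamma_integrand w \<omega>))"
      by (intro integrable_norm Bochner_Integration.integrable_diff integrable_sgn integrable_Gamma_integrand)
    show "AE \<omega> in M. norm (sgn (X \<omega> - m) - sgn (X \<omega> - (m + w)) - Gamma_integrand w \<omega>)
        \<le> 10 * (norm w)\<^sup>2 * (1 / (norm (X \<omega> - m))\<^sup>2)"
      using AE_X_neq[of m]
    proof eventually_elim
      case (elim \<omega>)
      thus ?case using sgn_expansion[of "X \<omega> - m" w] by (simp add: diff_diff_eq)
    qed
  qed
  also have "\<dots> = 10 * (norm w)\<^sup>2 * expectation (\<lambda>\<omega>. 1 / (norm (X \<omega> - m))\<^sup>2)"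
    by (rule integral_mult_right_zero)
  also have "\<dots> \<le> 10 * (norm w)\<^sup>2 * C"
    using inverse_norm_2 by (intro mult_left_mono) auto
  finally show ?thesis by (simp add: mult_ac)
qed

lemma grad_inner_eq:
  "grad h \<bullet> (h - m) = expectation (\<lambda>\<omega>. (sgn (X \<omega> - m) - sgn (X \<omega> - h)) \<bullet> ((X \<omega> - m) - (X \<omega> - h)))"
proof -
  have "grad h \<bullet> (h - m) = expectation (\<lambda>\<omega>. sgn (X \<omega> - m) - sgn (X \<omega> - h)) \<bullet> (h - m)"
    using grad_diff[of h m] by (simp add: grad_median)
  also have "\<dots> = expectation (\<lambda>\<omega>. (sgn (X \<omega> - m) - sgn (X \<omega> - h)) \<bullet> (h - m))"
    by (subst integral_inner_left) auto
  finally show ?thesis by simp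
qed

text \<open>
The gradient vanishes at \<open>m\<close>, so \<open>\<langle>grad h, h - m\<rangle>\<close> is the expectation of the nonnegative quantity
estimated in \<open>sgn_diff_inner_ge\<close>. Among three non-collinear points of the support, at least one is far
from the line through \<open>m\<close> and \<open>h\<close>. On the event that \<open>X\<close> is near this point, whose probability is bounded
below independently of \<open>h\<close>, both \<open>\<bar>X - m\<bar>\<close> and \<open>\<bar>X - h\<bar>\<close> are at most \<open>R\<close> and the integrand is of order
\<open>\<bar>h - m\<bar>^2\<close>.
\<close>
lemma grad_strongly_monotone:
  assumes "A > 0"
  shows "\<exists>c>0. \<forall>h. norm (h - m) \<le> A \<longrightarrow> grad h \<bullet> (h - m) \<ge> c * (norm (h - m))\<^sup>2"
proof -
  obtain p0 p1 p2 where p: "p0 \<in> support M X" "p1 \<in> support M X" "p2 \<in> support M X"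
    "((p1 - p0) \<bullet> (p2 - p0))\<^sup>2 < (norm (p1 - p0))\<^sup>2 * (norm (p2 - p0))\<^sup>2"
    by (rule not_collinear_support[OF prob_space_axioms X_meas nondegenerate])
  obtain \<eta> where \<eta>: "\<eta> > 0"
    "\<And>u c. norm u = 1 \<Longrightarrow> \<exists>p\<in>{p0,p1,p2}. norm (orth_part u (p - c)) \<ge> \<eta>"
    using triangle_far_from_line[OF p(4)] by auto
  \<comment> \<open>points of a ball of radius \<open>\<eta> / 2\<close> around a point at distance \<open>\<eta>\<close> from a line stay \<open>\<eta> / 2\<close> away from it\<close>
  define r where "r = \<eta> / 2"
  define P where "P = {p0, p1, p2}"
  define q where "q = Min ((\<lambda>p. prob {\<omega> \<in> space M. X \<omega> \<in> ball p r}) ` P)"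
  define R where "R = A + r + Max ((\<lambda>p. norm (p - m)) ` P)"
  have r: "r > 0" using \<eta> by (simp add: r_def)
  have P: "finite P" "P \<noteq> {}" "P \<subseteq> support M X" using p by (auto simp: P_def)
  have q: "q > 0"
    unfolding q_def using P r by (subst Min_gr_iff) (auto simp: support_def)
  have "norm (p0 - m) \<le> Max ((\<lambda>p. norm (p - m)) ` P)"
    by (intro Max_ge) (auto simp: P_def)
  hence "0 \<le> Max ((\<lambda>p. norm (p - m)) ` P)"
    using norm_ge_zero order_trans by blast
  hence R: "R > 0" using assms r by (simp add: R_def)
  define c where "c = q * (r\<^sup>2 / R ^ 3)"
  have c: "c > 0" using q r R by (simp add: c_def)
  show ?thesis
  proof (intro exI[of _ c] conjI c allI impI)
    fix h assume h: "norm (h - m) \<le> A"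
    show "c * (norm (h - m))\<^sup>2 \<le> grad h \<bullet> (h - m)"
    proof (cases "h = m")
      case False
      define u s where "u = sgn (h - m)" and "s = norm (h - m)"
      have u: "norm u = 1" and hm: "h - m = s *\<^sub>R u"
        using False by (auto simp: u_def s_def norm_sgn sgn_div_norm)
      obtain p where p: "p \<in> P" "norm (orth_part u (p - m)) \<ge> \<eta>"
        using \<eta>(2)[OF u, of m] by (auto simp: P_def)
      define B where "B = {\<omega> \<in> space M. X \<omega> \<in> ball p r}"
      have B [measurable]: "B \<in> sets M"
        using measurable_sets[OF X_meas, of "ball p r"] by (simp add: B_def vimage_def Int_def conj_commute)
      have pm: "norm (p - m) \<le> Max ((\<lambda>p. norm (p - m)) ` P)"
        using p by (intro Max_ge) (auto simp: P_def)
      have "q * (s\<^sup>2 * (r\<^sup>2 / R ^ 3)) \<le> prob B * (s\<^sup>2 * (r\<^sup>2 / R ^ 3))"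
      proof (rule mult_right_mono)
        show "q \<le> prob B" unfolding q_def B_def using p by (intro Min_le) (auto simp: P_def)
      qed (use R in auto)
      also have "\<dots> = expectation (\<lambda>\<omega>. indicator B \<omega> * (s\<^sup>2 * (r\<^sup>2 / R ^ 3)))"
        by simp
      also have "\<dots> \<le> expectation (\<lambda>\<omega>. (sgn (X \<omega> - m) - sgn (X \<omega> - h)) \<bullet> ((X \<omega> - m) - (X \<omega> - h)))"
      proof (rule integral_mono_AE)
        show "integrable M (\<lambda>\<omega>. (sgn (X \<omega> - m) - sgn (X \<omega> - h)) \<bullet> ((X \<omega> - m) - (X \<omega> - h)))"
          by (simp add: integrable_inner_left)
        show "AE \<omega> in M. indicator B \<omega> * (s\<^sup>2 * (r\<^sup>2 / R ^ 3))
            \<le> (sgn (X \<omega> - m) - sgn (X \<omega> - h)) \<bullet> ((X \<omega> - m) - (X \<omega> - h))"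
          using AE_X_neq[of m] AE_X_neq[of h]
        proof eventually_elim
          case (elim \<omega>)
          show ?case
          proof (cases "\<omega> \<in> B")
            case True
            define x y where "x = X \<omega> - m" and "y = X \<omega> - h"
            have xy0: "x \<noteq> 0" "y \<noteq> 0" using elim by (auto simp: x_def y_def)
            have xy: "x - y = s *\<^sub>R u" using hm by (simp add: x_def y_def)
            have dp: "norm (X \<omega> - p) < r" using True by (simp add: B_def dist_norm norm_minus_commute)
            have x: "norm x \<le> R"
              using dp pm assms norm_triangle_ineq[of "X \<omega> - p" "p - m"] by (simp add: R_def x_def)
            have y: "norm y \<le> R"
            proof -
              have "y = (X \<omega> - p) + (p - m) - (h - m)" by (simp add: y_def)
              hence "norm y \<le> norm (X \<omega> - p) + norm (p - m) + norm (h - m)"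
                by (metis norm_triangle_ineq norm_triangle_ineq4 add_right_mono order_trans)
              thus ?thesis using dp pm h by (simp add: R_def)
            qed
            have "norm (orth_part u (p - m)) \<le> norm (orth_part u x) + norm (orth_part u (X \<omega> - p))"
              using norm_triangle_ineq4[of "orth_part u x" "orth_part u (X \<omega> - p)"] by (simp add: x_def orth_part_diff[symmetric])
            moreover have "norm (orth_part u (X \<omega> - p)) \<le> r" using norm_orth_part_le[OF u] dp order_trans less_imp_le by blast
            ultimately have off: "r \<le> norm (orth_part u x)" using p(2) by (simp add: r_def)
            define a b where "a = norm x" and "b = norm y"
            have ab: "0 < a" "a \<le> R" "0 < b" "b \<le> R" using xy0 x y by (auto simp: a_def b_def)
            have "a\<^sup>2 * b\<^sup>2 - (x \<bullet> y)\<^sup>2 = (norm x)\<^sup>2 * (norm (x - y))\<^sup>2 - (x \<bullet> (x - y))\<^sup>2"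
              by (simp add: a_def b_def power2_norm_eq_inner inner_diff_left inner_diff_right inner_commute)
                 (simp add: power2_eq_square algebra_simps)
            also have "\<dots> = s\<^sup>2 * (norm (orth_part u x))\<^sup>2"
              unfolding xy by (rule gram_orth_part[OF u])
            finally have gram: "a\<^sup>2 * b\<^sup>2 - (x \<bullet> y)\<^sup>2 = s\<^sup>2 * (norm (orth_part u x))\<^sup>2" .
            have "1 / R ^ 3 \<le> (a + b) / (2 * a\<^sup>2 * b\<^sup>2)"
            proof -
              have "a * b\<^sup>2 \<le> R * R\<^sup>2" "a\<^sup>2 * b \<le> R\<^sup>2 * R"
                using ab by (auto intro!: mult_mono power_mono)
              hence "1 / R ^ 3 \<le> 1 / (a * b\<^sup>2)" "1 / R ^ 3 \<le> 1 / (a\<^sup>2 * b)"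
                using ab by (auto intro!: divide_left_mono simp: power2_eq_square power3_eq_cube)
              moreover have "(a + b) / (2 * a\<^sup>2 * b\<^sup>2) = (1 / (a * b\<^sup>2) + 1 / (a\<^sup>2 * b)) / 2"
                using ab by (simp add: field_simps power2_eq_square)
              moreover have "z \<le> (p + q) / 2" if "z \<le> p" "z \<le> q" for z p q :: real
                using that by simp
              ultimately show ?thesis by metis
            qed
            hence "(s\<^sup>2 * r\<^sup>2) * (1 / R ^ 3) \<le> (s\<^sup>2 * (norm (orth_part u x))\<^sup>2) * ((a + b) / (2 * a\<^sup>2 * b\<^sup>2))"
              using off r R by (intro mult_mono mult_left_mono power_mono) auto
            also have "\<dots> \<le> (sgn x - sgn y) \<bullet> (x - y)"
              using sgn_diff_inner_ge[OF xy0] by (simp add: gram[symmetric] a_def b_def)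
            finally show ?thesis using True by (simp add: x_def y_def)
          next
            case False
            thus ?thesis using sgn_diff_inner_nonneg[of "X \<omega> - m" "X \<omega> - h"] by simp
          qed
        qed
      qed (auto intro!: integrable_mult_left integrable_real_indicator simp: emeasure_eq_measure)
      also have "\<dots> = grad h \<bullet> (h - m)" by (rule grad_inner_eq[symmetric])
      finally show ?thesis by (simp add: c_def s_def mult_ac)
    qed simp
  qed
qed

end

section \<open>Two sums and a recursion of powers\<close>

text \<open>
The bound \<open>K' n^(-\<alpha>)\<close> decreases by at most \<open>K' n^(-\<alpha>) / (n + 1)\<close> from \<open>n\<close> to \<open>n + 1\<close>, and for
\<open>\<alpha> < 1\<close> this is small compared with the contraction \<open>\<beta> K' n^(-2\<alpha>)\<close>. For large \<open>n\<close> half of the contraction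
pays for the decrease and, if \<open>K' \<ge> 2 K / \<beta>\<close>, the other half pays for the forcing term. Finitely many
initial terms are absorbed into \<open>K'\<close>.
\<close>
lemma powr_recursion_bound:
  fixes a :: "nat \<Rightarrow> real" and \<alpha> \<beta> K :: real
  assumes \<alpha>: "0 < \<alpha>" "\<alpha> < 1" and \<beta>: "\<beta> > 0" and K: "K \<ge> 0"
    and nonneg: "\<And>n. a n \<ge> 0"
    and rec: "\<And>n. n \<ge> 1 \<Longrightarrow>
      a (Suc n) \<le> (1 - \<beta> * real n powr - \<alpha>) * a n + K * (real n powr - \<alpha>)\<^sup>2"
  shows "\<exists>K'\<ge>0. \<forall>n\<ge>1. a n \<le> K' * real n powr - \<alpha>"
proof -
  have lim1: "(\<lambda>n::nat. real n powr (\<alpha> - 1)) \<longlonglongrightarrow> 0"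
    using \<alpha> by (intro tendsto_neg_powr filterlim_real_sequentially) auto
  have lim2: "(\<lambda>n::nat. real n powr - \<alpha>) \<longlonglongrightarrow> 0"
    using \<alpha> by (intro tendsto_neg_powr filterlim_real_sequentially) auto
  have "\<forall>\<^sub>F n in sequentially. real n powr (\<alpha> - 1) < \<beta> / 2 \<and> real n powr - \<alpha> < 1 / \<beta>"
    using order_tendstoD(2)[OF lim1, of "\<beta> / 2"] order_tendstoD(2)[OF lim2, of "1 / \<beta>"] \<beta>
    by (simp add: eventually_conj)
  then obtain N where N: "\<And>n. n \<ge> N \<Longrightarrow> real n powr (\<alpha> - 1) < \<beta> / 2"
      "\<And>n. n \<ge> N \<Longrightarrow> real n powr - \<alpha> < 1 / \<beta>"
    by (auto simp: eventually_sequentially)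
  define N' where "N' = max N 1"
  define K' where "K' = 2 * K / \<beta> + (\<Sum>n=1..N'. a n * real n powr \<alpha>)"
  have S: "0 \<le> (\<Sum>n=1..N'. a n * real n powr \<alpha>)" by (intro sum_nonneg mult_nonneg_nonneg nonneg) auto
  have K': "K' \<ge> 0" "2 * K / \<beta> \<le> K'" using S K \<beta> by (auto simp: K'_def)
  have small: "a n \<le> K' * real n powr - \<alpha>" if n: "1 \<le> n" "n \<le> N'" for n
  proof -
    have "a n * real n powr \<alpha> \<le> (\<Sum>n=1..N'. a n * real n powr \<alpha>)"
      using n nonneg by (intro member_le_sum) auto
    also have "\<dots> \<le> K'" using K \<beta> by (simp add: K'_def)
    finally have "a n \<le> K' / real n powr \<alpha>"
      using n by (subst pos_le_divide_eq) auto
    thus ?thesis by (simp add: powr_minus divide_inverse)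
  qed
  have large: "a n \<le> K' * real n powr - \<alpha>" if "n \<ge> N'" for n
    using that
  proof (induction n rule: dec_induct)
    case base
    thus ?case using small[of N'] by (simp add: N'_def)
  next
    case (step n)
    have n: "n \<ge> 1" "n \<ge> N" using step by (auto simp: N'_def)
    define x where "x = real n powr - \<alpha>"
    have x: "x > 0" using n by (simp add: x_def)
    have "\<beta> * x \<le> 1" using N(2)[OF n(2)] \<beta> by (simp add: x_def field_simps)
    have "a (Suc n) \<le> (1 - \<beta> * x) * a n + K * x\<^sup>2"
      using rec[OF n(1)] by (simp add: x_def)
    also have "\<dots> \<le> (1 - \<beta> * x) * (K' * x) + K * x\<^sup>2"
      using step.IH \<open>\<beta> * x \<le> 1\<close> by (intro add_right_mono mult_left_mono) (auto simp: x_def)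
    also have "\<dots> \<le> K' * (x * (1 - 1 / (real n + 1)))"
    proof -
      have "1 / (real n + 1) \<le> (\<beta> / 2) * x"
      proof -
        have "1 / (real n + 1) \<le> 1 / real n" using n by (simp add: field_simps)
        also have "1 / real n = real n powr (\<alpha> - 1) * x"
        proof -
          have "real n powr (\<alpha> - 1) * x = real n powr - 1"
            unfolding x_def powr_add[symmetric] by simp
          thus ?thesis using n by (simp add: powr_minus_divide)
        qed
        also have "\<dots> \<le> (\<beta> / 2) * x"
          using N(1)[OF n(2)] x by (intro mult_right_mono) auto
        finally show ?thesis .
      qed
      hence "K' * (x * (1 / (real n + 1))) \<le> K' * (x * ((\<beta> / 2) * x))"
        using K' x by (intro mult_left_mono) auto
      moreover have "K * x\<^sup>2 \<le> (K' * \<beta> / 2) * x\<^sup>2"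
        using K' \<beta> by (intro mult_right_mono) (auto simp: field_simps)
      moreover have "(1 - \<beta> * x) * (K' * x) = K' * x - K' * (x * ((\<beta> / 2) * x)) - (K' * \<beta> / 2) * x\<^sup>2"
        by (simp add: algebra_simps power2_eq_square)
      moreover have "K' * (x * (1 - 1 / (real n + 1))) = K' * x - K' * (x * (1 / (real n + 1)))"
        by (simp only: right_diff_distrib mult_1_right)
      ultimately show ?thesis by linarith
    qed
    also have "x * (1 - 1 / (real n + 1)) \<le> real (Suc n) powr - \<alpha>"
    proof -
      define y where "y = real n / (real n + 1)"
      have y: "0 < y" "y \<le> 1" using n by (auto simp: y_def)
      have "y = y powr 1" using y by simp
      also have "\<dots> \<le> y powr \<alpha>" using y \<alpha> by (intro powr_mono') auto
      finally have "x * y \<le> x * y powr \<alpha>" using x by (intro mult_left_mono) auto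
      also have "x * y powr \<alpha> = (real n + 1) powr - \<alpha>"
        using n by (simp add: x_def y_def powr_divide powr_minus_divide)
      finally have "x * y \<le> (real n + 1) powr - \<alpha>" .
      moreover have "y = 1 - 1 / (real n + 1)" by (simp add: y_def field_simps)
      ultimately show ?thesis by (simp add: add.commute)
    qed
    hence "K' * (x * (1 - 1 / (real n + 1))) \<le> K' * real (Suc n) powr - \<alpha>"
      using K' by (intro mult_left_mono) auto
    finally show ?case .
  qed
  show ?thesis using K' small large by (intro exI[of _ K']) (metis nat_le_linear)
qed

lemma sum_powr_minus_le:
  assumes "0 < \<alpha>" "\<alpha> < 1"
  shows "(\<Sum>k=1..n. real k powr - \<alpha>) \<le> real n powr (1 - \<alpha>) / (1 - \<alpha>)"
proof (induction n)
  case (Suc n)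
  have "(1 - \<alpha>) * real (Suc n) powr - \<alpha> \<le> real (Suc n) powr (1 - \<alpha>) - real n powr (1 - \<alpha>)"
  proof (cases "n = 0")
    case False
    have "\<exists>z>real n. z < real (Suc n) \<and> real (Suc n) powr (1 - \<alpha>) - real n powr (1 - \<alpha>) =
       (real (Suc n) - real n) * ((1 - \<alpha>) * z powr (- \<alpha>))"
      using False assms by (intro MVT2) (auto intro!: derivative_eq_intros)
    then obtain z where z: "z > real n" "z < real (Suc n)" and eq: "real (Suc n) powr (1 - \<alpha>) - real n powr (1 - \<alpha>) =
       (1 - \<alpha>) * z powr (- \<alpha>)" by auto
    have "real (Suc n) powr - \<alpha> \<le> z powr - \<alpha>"
      using z assms by (intro powr_mono2') auto
    thus ?thesis unfolding eq using assms by (intro mult_left_mono) auto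
  qed (use assms in auto)
  with Suc assms show ?case by (simp add: field_simps)
qed simp

text \<open>
With \<open>x = (k + 1)^(\<alpha>/2)\<close> and \<open>y = k^(\<alpha>/2)\<close> the summand is \<open>(x^2 - y^2) / x \<le> 2 (x - y)\<close>, which telescopes.
\<close>
lemma sum_powr_increments_le:
  assumes "0 < \<alpha>"
  shows "(\<Sum>k=1..n. (real (Suc k) powr \<alpha> - real k powr \<alpha>) * real (Suc k) powr (- \<alpha> / 2))
    \<le> 2 * real (Suc n) powr (\<alpha> / 2)"
proof (induction n)
  case (Suc n)
  define x y where "x = real (Suc (Suc n)) powr (\<alpha> / 2)" and "y = real (Suc n) powr (\<alpha> / 2)"
  have xy: "0 < y" "y \<le> x" using assms by (auto simp: x_def y_def intro!: powr_mono2)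
  have "(real (Suc (Suc n)) powr \<alpha> - real (Suc n) powr \<alpha>) * real (Suc (Suc n)) powr (- \<alpha> / 2) = (x\<^sup>2 - y\<^sup>2) / x"
  proof -
    have sq: "z powr \<alpha> = (z powr (\<alpha> / 2))\<^sup>2" for z :: real
      unfolding power2_eq_square powr_add[symmetric] by simp
    have "z powr (- \<alpha> / 2) = 1 / z powr (\<alpha> / 2)" for z :: real
      using powr_minus_divide[of z "\<alpha> / 2"] by simp
    thus ?thesis unfolding x_def y_def sq by simp
  qed
  also have "\<dots> = (x - y) * ((x + y) / x)" by (simp add: power2_eq_square algebra_simps)
  also have "\<dots> \<le> (x - y) * 2" using xy by (intro mult_left_mono) (auto simp: field_simps)
  finally show ?case using Suc by (simp add: x_def y_def)
qed simp

section \<open>An exponential inequality for Hilbert space valued martingales\<close>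

text \<open>
The power series of \<open>cosh (sqrt t)\<close> in \<open>t\<close> has nonnegative coefficients.
\<close>
lemma cosh_sqrt_convex: "convex_on {0..} (\<lambda>t. cosh (sqrt t))"
proof -
  have s: "(\<lambda>n. t ^ n / fact (2 * n)) sums cosh (sqrt t)" if "t \<ge> 0" for t :: real
  proof -
    have "(\<lambda>n. if even n then sqrt t ^ n /\<^sub>R fact n else 0) sums cosh (sqrt t)"
      by (rule cosh_converges)
    hence "(\<lambda>n. sqrt t ^ (2*n) /\<^sub>R fact (2*n)) sums cosh (sqrt t)"
      by (subst (asm) sums_mono_reindex[symmetric, of "\<lambda>n. 2 * n"]) (auto simp: strict_mono_def elim!: evenE)
    moreover have "sqrt t ^ (2 * n) /\<^sub>R fact (2 * n) = t ^ n / fact (2 * n)" for n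
      using that by (simp add: power_mult divide_inverse)
    ultimately show ?thesis by simp
  qed
  show ?thesis
  proof (rule convex_onI)
    fix t x y :: real
    assume t: "0 < t" "t < 1" and xy: "x \<in> {0..}" "y \<in> {0..}"
    have c: "((1 - t) * x + t * y) ^ n / fact (2 * n) \<le> (1 - t) * (x ^ n / fact (2 * n)) + t * (y ^ n / fact (2 * n))" for n
    proof -
      have "((1 - t) * x + t * y) ^ n \<le> (1 - t) * x ^ n + t * y ^ n"
        using convex_onD[of "{0..}" "\<lambda>x. x ^ n" t x y] t xy
          convex_on_subset[OF convex_power_even[of n]] convex_power_odd[of n]
        by (cases "even n") auto
      hence "((1 - t) * x + t * y) ^ n / fact (2 * n) \<le> ((1 - t) * x ^ n + t * y ^ n) / fact (2 * n)"
        by (rule divide_right_mono) simp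
      thus ?thesis by (simp add: add_divide_distrib)
    qed
    have "cosh (sqrt ((1 - t) * x + t * y)) \<le> (1 - t) * cosh (sqrt x) + t * cosh (sqrt y)"
    proof (rule sums_le[OF c])
      show "(\<lambda>n. ((1 - t) * x + t * y) ^ n / fact (2 * n)) sums cosh (sqrt ((1 - t) * x + t * y))"
        using t xy by (intro s) simp
      show "(\<lambda>n. (1 - t) * (x ^ n / fact (2 * n)) + t * (y ^ n / fact (2 * n))) sums
         ((1 - t) * cosh (sqrt x) + t * cosh (sqrt y))"
        using xy by (intro sums_add sums_mult s) auto
    qed
    thus "cosh (sqrt ((1 - t) *\<^sub>R x + t *\<^sub>R y)) \<le> (1 - t) * cosh (sqrt x) + t * cosh (sqrt y)"
      by simp
  qed simp
qed

text \<open>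
For \<open>\<bar>y\<bar> = b\<close> the right-hand side is that of the hyperbolic law of cosines, and the lemma says that a
Euclidean triangle with two given sides and the enclosed angle has a third side at most as long as that of
a hyperbolic one. Indeed, for fixed norms \<open>\<bar>x + y\<bar>^2\<close> is affine in the cosine \<open>c\<close> of the angle, hence the
left-hand side is convex in \<open>c\<close>, the right-hand side is affine in \<open>c\<close>, and both agree at \<open>c = 1\<close> and
\<open>c = -1\<close>. Replacing \<open>\<bar>y\<bar>\<close> by an upper bound \<open>b\<close> keeps the coefficient of \<open>\<langle>x, y\<rangle>\<close> independent of \<open>y\<close>; the last
term then vanishes in expectation when \<open>y\<close> is a martingale increment.
\<close>
lemma cosh_norm_add_le:
  fixes x y :: "'a::real_inner"
  assumes "norm y \<le> b" "b > 0"
  shows "cosh (norm (x + y))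
    \<le> cosh b * cosh (norm x) + (sinh b / b) * (sinh (norm x) / norm x) * (x \<bullet> y)"
proof (cases "x = 0")
  case True
  have "cosh (norm y) \<le> cosh b" using assms by (subst cosh_real_nonneg_le_iff) auto
  with True show ?thesis by simp
next
  case False
  define a c where "a = norm x" and "c = (x \<bullet> y) / (a * b)"
  \<comment> \<open>\<open>\<bar>x + y\<bar>^2\<close> is at most the convex combination with weight \<open>t\<close> of its values at angles \<open>\<pi>\<close> and \<open>0\<close>\<close>
  define t where "t = (1 + c) / 2"
  have a: "a > 0" using False by (simp add: a_def)
  have "\<bar>x \<bullet> y\<bar> \<le> a * b"
    using Cauchy_Schwarz_ineq2[of x y] assms a
    by (smt (verit) a_def mult_left_mono)
  hence t: "0 \<le> t" "t \<le> 1" using a assms(2) by (auto simp: t_def c_def field_simps)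
  have xy: "x \<bullet> y = c * (a * b)" using a assms by (simp add: c_def)
  have "(norm (x + y))\<^sup>2 = a\<^sup>2 + 2 * (x \<bullet> y) + (norm y)\<^sup>2"
    by (simp add: a_def power2_norm_eq_inner inner_add_left inner_add_right inner_commute)
  also have "\<dots> \<le> a\<^sup>2 + 2 * (x \<bullet> y) + b\<^sup>2"
    using assms by (simp add: power_mono)
  also have "\<dots> = (1 - t) * (a - b)\<^sup>2 + t * (a + b)\<^sup>2"
    by (simp add: xy t_def power2_eq_square field_simps)
  finally have le: "norm (x + y) \<le> sqrt ((1 - t) * (a - b)\<^sup>2 + t * (a + b)\<^sup>2)"
    by (simp add: real_le_rsqrt)
  hence "cosh (norm (x + y)) \<le> cosh (sqrt ((1 - t) * (a - b)\<^sup>2 + t * (a + b)\<^sup>2))"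
    by (subst cosh_real_nonneg_le_iff) (use t in \<open>auto intro!: add_nonneg_nonneg\<close>)
  also have "\<dots> \<le> (1 - t) * cosh (sqrt ((a - b)\<^sup>2)) + t * cosh (sqrt ((a + b)\<^sup>2))"
    using convex_onD[OF cosh_sqrt_convex, of t "(a - b)\<^sup>2" "(a + b)\<^sup>2"] t by simp
  also have "\<dots> = (1 - t) * cosh (a - b) + t * cosh (a + b)"
    by (simp)
  also have "\<dots> = cosh b * cosh a + c * sinh a * sinh b"
    by (simp add: cosh_add cosh_diff t_def field_simps)
  also have "c * sinh a * sinh b = (sinh b / b) * (sinh a / a) * (x \<bullet> y)"
    using a assms by (simp add: xy)
  finally show ?thesis by (simp add: a_def)
qed

text \<open>This is Hoeffding's lemma for a random sign.\<close>
lemma cosh_le_exp_half_square: "cosh x \<le> exp (x\<^sup>2 / 2)" for x :: real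
proof -
  have *: "cosh y \<le> exp (y\<^sup>2 / 2)" if "y \<ge> 0" for y :: real
  proof -
    have "ln (1 + 1/2 * (exp (2 * y) - 1)) \<le> y + y\<^sup>2 / 2"
      using Hoeffdings_lemma_aux[of "2 * y" "1/2"] that by (simp add: power_mult_distrib)
    hence "exp (ln (1 + 1/2 * (exp (2 * y) - 1))) \<le> exp (y + y\<^sup>2 / 2)"
      by (subst exp_le_cancel_iff)
    moreover have "1 + 1/2 * (exp (2 * y) - 1) > 0"
      using exp_gt_zero[of "2 * y"] unfolding right_diff_distrib by linarith
    ultimately have "1 + 1/2 * (exp (2 * y) - 1) \<le> exp (y + y\<^sup>2 / 2)"
      by (subst (asm) exp_ln)
    hence "exp y * cosh y \<le> exp y * exp (y\<^sup>2 / 2)"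
    proof -
      assume a: "1 + 1/2 * (exp (2 * y) - 1) \<le> exp (y + y\<^sup>2 / 2)"
      have "exp y * cosh y = 1/2 * (exp y * exp y + exp y * exp (- y))"
        by (simp add: cosh_field_def algebra_simps)
      also have "\<dots> = 1 + 1/2 * (exp (2 * y) - 1)"
        by (simp flip: exp_add) (simp add: field_simps)
      finally show ?thesis using a by (simp add: exp_add)
    qed
    thus ?thesis by simp
  qed
  from *[of "\<bar>x\<bar>"] show ?thesis by simp
qed

text \<open>
The last assumption states \<open>E[\<xi> n | F n] = 0\<close> weakly, by testing against bounded vectors that are
known at time \<open>n\<close>; this is the form in which the martingale property is used.
\<close>
locale bounded_martingale_differences = prob_space M for M :: "'w measure" +
  fixes F :: "nat \<Rightarrow> 'w measure"
    and \<xi> :: "nat \<Rightarrow> 'w \<Rightarrow> 'a::{real_inner, banach, second_countable_topology}"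
    and b :: real
  assumes subalg: "subalgebra M (F n)"
    and F_mono: "subalgebra (F (Suc n)) (F n)"
    and noise_adapted: "n \<ge> 1 \<Longrightarrow> \<xi> n \<in> borel_measurable (F (Suc n))"
    and b_pos: "b > 0"
    and noise_bound: "\<lbrakk>n \<ge> 1; \<omega> \<in> space M\<rbrakk> \<Longrightarrow> norm (\<xi> n \<omega>) \<le> b"
    and noise_orthogonal: "\<lbrakk>n \<ge> 1; W \<in> borel_measurable (F n);
       \<And>\<omega>. \<omega> \<in> space M \<Longrightarrow> norm (W \<omega>) \<le> B\<rbrakk> \<Longrightarrow> expectation (\<lambda>\<omega>. W \<omega> \<bullet> \<xi> n \<omega>) = 0"
begin

lemma measurable_from_F: "f \<in> measurable (F n) N \<Longrightarrow> f \<in> measurable M N"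
  by (rule measurable_from_subalg[OF subalg])

lemma measurable_F_Suc: "f \<in> measurable (F n) N \<Longrightarrow> f \<in> measurable (F (Suc n)) N"
  by (rule measurable_from_subalg[OF F_mono])

lemma noise_measurable: "n \<ge> 1 \<Longrightarrow> \<xi> n \<in> borel_measurable M"
  by (rule measurable_from_F[OF noise_adapted])

lemma integrable_bounded:
  fixes f :: "'w \<Rightarrow> 'c::{banach, second_countable_topology}"
  assumes "f \<in> borel_measurable M" "\<And>\<omega>. \<omega> \<in> space M \<Longrightarrow> norm (f \<omega>) \<le> B"
  shows "integrable M f"
  using assms by (intro integrable_const_bound[of _ B] AE_I2) auto

definition noise_sum :: "nat \<Rightarrow> 'w \<Rightarrow> 'a" where "noise_sum n \<omega> = (\<Sum>k=1..n. \<xi> k \<omega>)"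

lemma noise_sum_adapted: "noise_sum n \<in> borel_measurable (F (Suc n))"
proof (induction n)
  case (Suc n)
  have "(\<lambda>\<omega>. noise_sum n \<omega> + \<xi> (Suc n) \<omega>) \<in> borel_measurable (F (Suc (Suc n)))"
    using measurable_F_Suc[OF Suc] noise_adapted[of "Suc n"] by (intro borel_measurable_add) auto
  thus ?case by (simp add: noise_sum_def[abs_def])
qed (simp add: noise_sum_def[abs_def])

lemma norm_noise_sum_le: "\<omega> \<in> space M \<Longrightarrow> norm (noise_sum n \<omega>) \<le> real n * b"
  unfolding noise_sum_def using sum_norm_le[of "{1..n}" "\<lambda>k. \<xi> k \<omega>" "\<lambda>_. b"] noise_bound by simp

lemma cosh_measurable [measurable]: "cosh \<in> borel_measurable (borel :: real measure)"
  and sinh_measurable [measurable]: "sinh \<in> borel_measurable (borel :: real measure)"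
  by (intro borel_measurable_continuous_onI continuous_intros; simp)+

text \<open>
Each increment multiplies the expectation by at most \<open>cosh (l b)\<close>: the linear term of
\<open>cosh_norm_add_le\<close> is the inner product of the increment with a vector known beforehand.
\<close>
lemma expectation_cosh_le:
  assumes l: "l > 0"
  shows "integrable M (\<lambda>\<omega>. cosh (norm (l *\<^sub>R noise_sum n \<omega>)))"
    and "expectation (\<lambda>\<omega>. cosh (norm (l *\<^sub>R noise_sum n \<omega>))) \<le> cosh (l * b) ^ n"
proof -
  have int: "integrable M (\<lambda>\<omega>. cosh (norm (l *\<^sub>R noise_sum n \<omega>)))" for n
  proof (rule integrable_bounded)
    note [measurable] = measurable_from_F[OF noise_sum_adapted]
    show "(\<lambda>\<omega>. cosh (norm (l *\<^sub>R noise_sum n \<omega>))) \<in> borel_measurable M" by measurable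
    fix \<omega> assume "\<omega> \<in> space M"
    hence "norm (l *\<^sub>R noise_sum n \<omega>) \<le> l * (real n * b)"
      using norm_noise_sum_le l by (simp add: mult_left_mono)
    thus "norm (cosh (norm (l *\<^sub>R noise_sum n \<omega>))) \<le> cosh (l * (real n * b))"
      using l b_pos by (simp add: cosh_real_nonneg_le_iff)
  qed
  show "integrable M (\<lambda>\<omega>. cosh (norm (l *\<^sub>R noise_sum n \<omega>)))" by (rule int)
  show "expectation (\<lambda>\<omega>. cosh (norm (l *\<^sub>R noise_sum n \<omega>))) \<le> cosh (l * b) ^ n"
  proof (induction n)
    case 0
    show ?case by (simp add: noise_sum_def prob_space)
  next
    case (Suc n)
    define x where "x \<omega> = l *\<^sub>R noise_sum n \<omega>" for \<omega>
    define W where "W \<omega> = (sinh (norm (x \<omega>)) / norm (x \<omega>)) *\<^sub>R x \<omega>" for \<omega>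
    define k where "k = sinh (l * b) / (l * b) * l"
    note [measurable] = noise_sum_adapted[of n]
    have W: "W \<in> borel_measurable (F (Suc n))" unfolding W_def x_def by measurable
    have Wb: "norm (W \<omega>) \<le> sinh (l * (real n * b))" if "\<omega> \<in> space M" for \<omega>
    proof -
      have "norm (x \<omega>) \<le> l * (real n * b)"
        using norm_noise_sum_le[OF that] l by (simp add: x_def mult_left_mono)
      hence "sinh (norm (x \<omega>)) \<le> sinh (l * (real n * b))" by simp
      moreover have "norm (W \<omega>) = sinh (norm (x \<omega>))" by (auto simp: W_def)
      ultimately show ?thesis by simp
    qed
    have Wint: "integrable M (\<lambda>\<omega>. W \<omega> \<bullet> \<xi> (Suc n) \<omega>)"
    proof (rule integrable_bounded)
      show "(\<lambda>\<omega>. W \<omega> \<bullet> \<xi> (Suc n) \<omega>) \<in> borel_measurable M"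
        using measurable_from_F[OF W] noise_measurable[of "Suc n"] by simp
      fix \<omega> assume w: "\<omega> \<in> space M"
      have "\<bar>W \<omega> \<bullet> \<xi> (Suc n) \<omega>\<bar> \<le> norm (W \<omega>) * norm (\<xi> (Suc n) \<omega>)" by (rule Cauchy_Schwarz_ineq2)
      also have "\<dots> \<le> sinh (l * (real n * b)) * b"
        using Wb[OF w] noise_bound[OF _ w, of "Suc n"] by (intro mult_mono order_trans[OF norm_ge_zero Wb[OF w]]) auto
      finally show "norm (W \<omega> \<bullet> \<xi> (Suc n) \<omega>) \<le> sinh (l * (real n * b)) * b" by simp
    qed
    have "expectation (\<lambda>\<omega>. cosh (norm (l *\<^sub>R noise_sum (Suc n) \<omega>)))
        \<le> expectation (\<lambda>\<omega>. cosh (l * b) * cosh (norm (x \<omega>)) + k * (W \<omega> \<bullet> \<xi> (Suc n) \<omega>))"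
    proof (rule integral_mono[OF int])
      show "integrable M (\<lambda>\<omega>. cosh (l * b) * cosh (norm (x \<omega>)) + k * (W \<omega> \<bullet> \<xi> (Suc n) \<omega>))"
        using int[of n] Wint by (simp add: x_def)
      fix \<omega> assume w: "\<omega> \<in> space M"
      have "l *\<^sub>R noise_sum (Suc n) \<omega> = x \<omega> + l *\<^sub>R \<xi> (Suc n) \<omega>"
        by (simp add: noise_sum_def x_def scaleR_add_right)
      moreover have "norm (l *\<^sub>R \<xi> (Suc n) \<omega>) \<le> l * b"
        using noise_bound[OF _ w, of "Suc n"] l by (simp add: mult_left_mono)
      ultimately show "cosh (norm (l *\<^sub>R noise_sum (Suc n) \<omega>))
          \<le> cosh (l * b) * cosh (norm (x \<omega>)) + k * (W \<omega> \<bullet> \<xi> (Suc n) \<omega>)"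
        using cosh_norm_add_le[of "l *\<^sub>R \<xi> (Suc n) \<omega>" "l * b" "x \<omega>"] l b_pos
        by (simp add: k_def W_def mult_ac)
    qed
    also have "\<dots> = cosh (l * b) * expectation (\<lambda>\<omega>. cosh (norm (x \<omega>)))"
      using int[of n] Wint noise_orthogonal[OF _ W Wb] by (simp add: x_def)
    also have "\<dots> \<le> cosh (l * b) * cosh (l * b) ^ n"
      using Suc by (intro mult_left_mono) (auto simp: x_def)
    finally show ?case by simp
  qed
qed

text \<open>
Markov's inequality for the hyperbolic cosine of \<open>l\<close> times the norm, with the optimal \<open>l = r / (n b^2)\<close>. The constants do not depend
on the dimension of the space.
\<close>
theorem azuma_hoeffding:
  assumes n: "n \<ge> 1" and r: "r > 0"
  shows "prob {\<omega> \<in> space M. norm (noise_sum n \<omega>) \<ge> r} \<le> 2 * exp (- r\<^sup>2 / (2 * real n * b\<^sup>2))"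
proof -
  define l where "l = r / (real n * b\<^sup>2)"
  have l: "l > 0" using n r b_pos by (simp add: l_def)
  define P where "P = prob {\<omega> \<in> space M. norm (noise_sum n \<omega>) \<ge> r}"
  have "{\<omega> \<in> space M. norm (noise_sum n \<omega>) \<ge> r} = {\<omega> \<in> space M. cosh (norm (l *\<^sub>R noise_sum n \<omega>)) \<ge> cosh (l * r)}"
    using l r by (auto simp: cosh_real_nonneg_le_iff)
  hence "P \<le> expectation (\<lambda>\<omega>. cosh (norm (l *\<^sub>R noise_sum n \<omega>))) / cosh (l * r)"
    unfolding P_def
    using integral_Markov_inequality_measure[OF expectation_cosh_le(1)[OF l], of "{}" n "cosh (l * r)"]
    by simp
  also have "\<dots> \<le> exp (real n * ((l * b)\<^sup>2 / 2)) / (exp (l * r) / 2)"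
  proof (rule frac_le)
    show "expectation (\<lambda>\<omega>. cosh (norm (l *\<^sub>R noise_sum n \<omega>))) \<le> exp (real n * ((l * b)\<^sup>2 / 2))"
      unfolding exp_of_nat_mult
      by (rule order_trans[OF expectation_cosh_le(2)[OF l] power_mono[OF cosh_le_exp_half_square]])
         (simp add: cosh_real_nonneg)
    show "exp (l * r) / 2 \<le> cosh (l * r)" by (simp add: cosh_field_def)
  qed auto
  also have "\<dots> = 2 * exp (real n * ((l * b)\<^sup>2 / 2) - l * r)"
    by (simp add: exp_diff)
  also have "real n * ((l * b)\<^sup>2 / 2) - l * r = - r\<^sup>2 / (2 * real n * b\<^sup>2)"
    using n b_pos by (simp add: l_def field_simps power2_eq_square)
  finally show ?thesis by (simp add: P_def)
qed

end

section \<open>Robbins-Monro errors with a locally coercive drift\<close>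

text \<open>
\<open>T n\<close> is the error of a stochastic approximation scheme, which moves along the noise \<open>\<xi> n\<close> minus the
drift \<open>g n\<close>. Steps before scaling have norm at most 1, so the drift is bounded and cannot dominate
\<open>\<bar>T n\<bar>\<close> far away; coercivity is assumed on each ball, with a constant that depends on the ball.
\<close>
locale robbins_monro = bounded_martingale_differences M F \<xi> b
  for M :: "'w measure" and F
    and \<xi> :: "nat \<Rightarrow> 'w \<Rightarrow> 'a::{real_inner, banach, second_countable_topology}" and b +
  fixes T g :: "nat \<Rightarrow> 'w \<Rightarrow> 'a" and \<alpha> c\<^sub>0 B :: real
  assumes adapted: "n \<ge> 1 \<Longrightarrow> T n \<in> borel_measurable (F n)"
    and start: "\<omega> \<in> space M \<Longrightarrow> norm (T 1 \<omega>) \<le> B"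
    and \<alpha>: "1/2 < \<alpha>" "\<alpha> < 1" and c\<^sub>0: "c\<^sub>0 > 0"
    and step: "\<lbrakk>n \<ge> 1; \<omega> \<in> space M\<rbrakk> \<Longrightarrow>
       T (Suc n) \<omega> = T n \<omega> + (c\<^sub>0 * real n powr - \<alpha>) *\<^sub>R (\<xi> n \<omega> - g n \<omega>)"
    and step_bound: "\<lbrakk>n \<ge> 1; \<omega> \<in> space M\<rbrakk> \<Longrightarrow> norm (\<xi> n \<omega> - g n \<omega>) \<le> 1"
    and drift: "A > 0 \<Longrightarrow> \<exists>c>0. \<forall>n\<ge>1. \<forall>\<omega>\<in>space M. norm (T n \<omega>) \<le> A
       \<longrightarrow> g n \<omega> \<bullet> T n \<omega> \<ge> c * (norm (T n \<omega>))\<^sup>2"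
begin

abbreviation \<gamma> :: "nat \<Rightarrow> real" where "\<gamma> n \<equiv> c\<^sub>0 * real n powr - \<alpha>"

definition stays :: "real \<Rightarrow> nat \<Rightarrow> 'w set" where
  "stays A n = {\<omega> \<in> space M. \<forall>k\<in>{1..n}. norm (T k \<omega>) \<le> A}"

lemma T_measurable: "n \<ge> 1 \<Longrightarrow> T n \<in> borel_measurable M"
  by (rule measurable_from_F[OF adapted])

lemma norm_T_bound: "\<exists>K. \<forall>\<omega>\<in>space M. norm (T (Suc n) \<omega>) \<le> K"
proof (induction n)
  case 0
  show ?case using start by auto
next
  case (Suc n)
  then obtain K where K: "\<And>\<omega>. \<omega> \<in> space M \<Longrightarrow> norm (T (Suc n) \<omega>) \<le> K" by auto
  have "norm (T (Suc (Suc n)) \<omega>) \<le> K + \<gamma> (Suc n)" if w: "\<omega> \<in> space M" for \<omega>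
  proof -
    have "norm (T (Suc (Suc n)) \<omega>) \<le> norm (T (Suc n) \<omega>) + norm (\<gamma> (Suc n) *\<^sub>R (\<xi> (Suc n) \<omega> - g (Suc n) \<omega>))"
      using step[OF _ w, of "Suc n"] by (simp only: norm_triangle_ineq)
    also have "norm (\<gamma> (Suc n) *\<^sub>R (\<xi> (Suc n) \<omega> - g (Suc n) \<omega>)) \<le> \<gamma> (Suc n) * 1"
      using step_bound[OF _ w, of "Suc n"] c\<^sub>0 by (simp add: mult_left_le)
    finally show ?thesis using K[OF w] by simp
  qed
  thus ?case by blast
qed

lemma integrable_T_sq: assumes "n \<ge> 1" shows "integrable M (\<lambda>\<omega>. (norm (T n \<omega>))\<^sup>2)"
proof -
  obtain K where K: "\<And>\<omega>. \<omega> \<in> space M \<Longrightarrow> norm (T n \<omega>) \<le> K"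
    using norm_T_bound[of "n - 1"] assms by auto
  show ?thesis
  proof (rule integrable_bounded)
    show "(\<lambda>\<omega>. (norm (T n \<omega>))\<^sup>2) \<in> borel_measurable M"
      using T_measurable[OF assms] by simp
    show "norm ((norm (T n \<omega>))\<^sup>2) \<le> K\<^sup>2" if "\<omega> \<in> space M" for \<omega>
      using K[OF that] by (simp add: power_mono)
  qed
qed

lemma stays_adapted: "n \<ge> 1 \<Longrightarrow> stays A n \<in> sets (F n)"
proof (induction n rule: dec_induct)
  case base
  have [measurable]: "T 1 \<in> borel_measurable (F 1)" by (rule adapted) simp
  have "{\<omega> \<in> space (F 1). norm (T 1 \<omega>) \<le> A} \<in> sets (F 1)" by measurable
  moreover have "space (F 1) = space M" using subalg[of 1] by (simp add: subalgebra_def)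
  ultimately show ?case by (simp add: stays_def)
next
  case (step n)
  have [measurable]: "T (Suc n) \<in> borel_measurable (F (Suc n))" by (rule adapted) simp
  have "{\<omega> \<in> space (F (Suc n)). norm (T (Suc n) \<omega>) \<le> A} \<in> sets (F (Suc n))" by measurable
  moreover have "space (F (Suc n)) = space M" using subalg[of "Suc n"] by (simp add: subalgebra_def)
  ultimately have "{\<omega> \<in> space M. norm (T (Suc n) \<omega>) \<le> A} \<in> sets (F (Suc n))" by simp
  moreover have "stays A n \<in> sets (F (Suc n))"
    using step F_mono[of n] by (auto simp: subalgebra_def)
  ultimately have "stays A n \<inter> {\<omega> \<in> space M. norm (T (Suc n) \<omega>) \<le> A} \<in> sets (F (Suc n))"
    by (intro sets.Int)
  also have "stays A n \<inter> {\<omega> \<in> space M. norm (T (Suc n) \<omega>) \<le> A} = stays A (Suc n)"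
    using step(1) by (auto simp: stays_def le_Suc_eq)
  finally show ?case .
qed

lemma stays_events [measurable]: "n \<ge> 1 \<Longrightarrow> stays A n \<in> events"
  using stays_adapted[of n A] subalg[of n] by (auto simp: subalgebra_def)

lemma stays_antimono: "m \<le> n \<Longrightarrow> stays A n \<subseteq> stays A m"
  by (auto simp: stays_def)

lemma norm_T_Suc_sq_le:
  assumes "n \<ge> 1" and w: "\<omega> \<in> space M"
  shows "(norm (T (Suc n) \<omega>))\<^sup>2 \<le> (norm (T n \<omega>))\<^sup>2
     + 2 * \<gamma> n * (T n \<omega> \<bullet> \<xi> n \<omega>) - 2 * \<gamma> n * (g n \<omega> \<bullet> T n \<omega>) + (\<gamma> n)\<^sup>2"
proof -
  define u where "u = \<xi> n \<omega> - g n \<omega>"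
  have "(norm (T (Suc n) \<omega>))\<^sup>2 = (norm (T n \<omega>))\<^sup>2 + 2 * \<gamma> n * (T n \<omega> \<bullet> u) + (\<gamma> n)\<^sup>2 * (norm u)\<^sup>2"
    unfolding step[OF assms] u_def[symmetric] power2_norm_eq_inner inner_add_left inner_add_right
    by (simp add: inner_commute power2_eq_square)
  also have "(\<gamma> n)\<^sup>2 * (norm u)\<^sup>2 \<le> (\<gamma> n)\<^sup>2"
    using step_bound[OF assms] by (intro mult_left_le) (auto simp: u_def power_le_one)
  finally show ?thesis
    by (simp add: u_def inner_diff_right inner_commute algebra_simps)
qed

text \<open>
On \<open>stays A n\<close> the error is bounded, and this event is known at time \<open>n\<close>; the noise is therefore
orthogonal to the error restricted to it.
\<close>
lemma noise_stays:
  assumes n: "n \<ge> 1"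
  shows "integrable M (\<lambda>\<omega>. indicator (stays A n) \<omega> * (T n \<omega> \<bullet> \<xi> n \<omega>))"
    and "expectation (\<lambda>\<omega>. indicator (stays A n) \<omega> * (T n \<omega> \<bullet> \<xi> n \<omega>)) = 0"
proof -
  define W where "W \<omega> = indicator (stays A n) \<omega> *\<^sub>R T n \<omega>" for \<omega>
  note [measurable] = adapted[OF n] stays_adapted[OF n, of A]
  have W: "W \<in> borel_measurable (F n)" unfolding W_def by measurable
  have Wb: "norm (W \<omega>) \<le> max A 0" if "\<omega> \<in> space M" for \<omega>
  proof (cases "\<omega> \<in> stays A n")
    case True
    hence "norm (T n \<omega>) \<le> A" using n by (simp add: stays_def)
    thus ?thesis using True by (simp add: W_def)
  qed (simp add: W_def)
  have eq: "indicator (stays A n) \<omega> * (T n \<omega> \<bullet> \<xi> n \<omega>) = W \<omega> \<bullet> \<xi> n \<omega>" for \<omega>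
    by (simp add: W_def)
  show "integrable M (\<lambda>\<omega>. indicator (stays A n) \<omega> * (T n \<omega> \<bullet> \<xi> n \<omega>))"
    unfolding eq
  proof (rule integrable_bounded)
    show "(\<lambda>\<omega>. W \<omega> \<bullet> \<xi> n \<omega>) \<in> borel_measurable M"
      using measurable_from_F[OF W] noise_measurable[OF n] by simp
    fix \<omega> assume w: "\<omega> \<in> space M"
    have "\<bar>W \<omega> \<bullet> \<xi> n \<omega>\<bar> \<le> norm (W \<omega>) * norm (\<xi> n \<omega>)" by (rule Cauchy_Schwarz_ineq2)
    also have "\<dots> \<le> max A 0 * b"
      using Wb[OF w] noise_bound[OF n w] by (intro mult_mono) auto
    finally show "norm (W \<omega> \<bullet> \<xi> n \<omega>) \<le> max A 0 * b" by simp
  qed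
  show "expectation (\<lambda>\<omega>. indicator (stays A n) \<omega> * (T n \<omega> \<bullet> \<xi> n \<omega>)) = 0"
    unfolding eq by (rule noise_orthogonal[OF n W Wb])
qed

lemma integrable_stays_mult:
  assumes "n \<ge> 1" "integrable M f"
  shows "integrable M (\<lambda>\<omega>. indicator (stays A n) \<omega> * (f \<omega> :: real))"
  using integrable_real_mult_indicator[OF stays_events[OF assms(1)] assms(2), of A] by (simp add: mult.commute)

text \<open>
A maximal inequality. Up to the first exit from the ball, \<open>\<bar>T n\<bar>^2\<close> plus \<open>G\<close> minus the sum of the squared
gains spent so far is a supermartingale (the process \<open>V\<close> of the proof); at the exit it is at least
\<open>A^2\<close>, and from then on it is replaced by the constant \<open>A^2\<close>. The stopped process has nonincreasing expectation, starting
from at most \<open>B^2 + G\<close>.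
\<close>
lemma prob_stays:
  assumes A: "A > 0" "B \<le> A" and n: "n \<ge> 1" and G: "\<And>n. (\<Sum>k=1..n. (\<gamma> k)\<^sup>2) \<le> G"
  shows "A\<^sup>2 * (1 - prob (stays A n)) \<le> B\<^sup>2 + G"
proof -
  define R where "R n = G - (\<Sum>k=1..<n. (\<gamma> k)\<^sup>2)" for n
  have R: "R n \<ge> 0" for n
  proof -
    have "(\<Sum>k=1..<n. (\<gamma> k)\<^sup>2) \<le> (\<Sum>k=1..n. (\<gamma> k)\<^sup>2)" by (intro sum_mono2) auto
    thus ?thesis using G[of n] by (simp add: R_def)
  qed
  define V where "V n \<omega> = (norm (T n \<omega>))\<^sup>2 + R n" for n \<omega>
  have V: "V n \<omega> \<ge> 0" for n \<omega> using R by (simp add: V_def)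
  have Vint: "integrable M (V n)" if "n \<ge> 1" for n
    unfolding V_def using integrable_T_sq[OF that] by simp
  define I where "I n \<omega> = (indicator (stays A n) \<omega> :: real)" for n \<omega>
  have Iint: "integrable M (I n)" if "n \<ge> 1" for n
    unfolding I_def using stays_events[OF that] by (simp add: emeasure_eq_measure)
  have Jint: "integrable M (\<lambda>\<omega>. I n \<omega> * V n \<omega> + A\<^sup>2 * (1 - I n \<omega>))" if "n \<ge> 1" for n
    using integrable_stays_mult[OF that Vint[OF that], of A] Iint[OF that]
    by (simp add: I_def[abs_def])
  have "expectation (\<lambda>\<omega>. I n \<omega> * V n \<omega> + A\<^sup>2 * (1 - I n \<omega>)) \<le> B\<^sup>2 + G"
    using n
  proof (induction n rule: dec_induct)
    case base
    have "expectation (\<lambda>\<omega>. I 1 \<omega> * V 1 \<omega> + A\<^sup>2 * (1 - I 1 \<omega>)) \<le> expectation (\<lambda>_. B\<^sup>2 + G)"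
    proof (rule integral_mono)
      show "integrable M (\<lambda>\<omega>. I 1 \<omega> * V 1 \<omega> + A\<^sup>2 * (1 - I 1 \<omega>))"
        by (rule Jint) simp
      fix \<omega> assume w: "\<omega> \<in> space M"
      have "(norm (T 1 \<omega>))\<^sup>2 \<le> B\<^sup>2" using start[OF w] by (intro power_mono) auto
      moreover have "I 1 \<omega> = 1" using start[OF w] A w by (auto simp: I_def stays_def)
      ultimately show "I 1 \<omega> * V 1 \<omega> + A\<^sup>2 * (1 - I 1 \<omega>) \<le> B\<^sup>2 + G" by (simp add: V_def R_def)
    qed simp
    thus ?case by (simp add: prob_space)
  next
    case (step n)
    hence n: "n \<ge> 1" "Suc n \<ge> 1" by auto
    have "expectation (\<lambda>\<omega>. I (Suc n) \<omega> * V (Suc n) \<omega> + A\<^sup>2 * (1 - I (Suc n) \<omega>))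
      \<le> expectation (\<lambda>\<omega>. (I n \<omega> * V n \<omega> + A\<^sup>2 * (1 - I n \<omega>)) + (2 * \<gamma> n) * (I n \<omega> * (T n \<omega> \<bullet> \<xi> n \<omega>)))"
    proof (rule integral_mono)
      show "integrable M (\<lambda>\<omega>. I (Suc n) \<omega> * V (Suc n) \<omega> + A\<^sup>2 * (1 - I (Suc n) \<omega>))"
        by (rule Jint[OF n(2)])
      show "integrable M (\<lambda>\<omega>. (I n \<omega> * V n \<omega> + A\<^sup>2 * (1 - I n \<omega>)) + (2 * \<gamma> n) * (I n \<omega> * (T n \<omega> \<bullet> \<xi> n \<omega>)))"
        using noise_stays(1)[OF n(1), of A]
        by (intro Bochner_Integration.integrable_add[OF Jint[OF n(1)]] integrable_mult_right) (simp add: I_def)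
      fix \<omega> assume w: "\<omega> \<in> space M"
      show "I (Suc n) \<omega> * V (Suc n) \<omega> + A\<^sup>2 * (1 - I (Suc n) \<omega>)
         \<le> (I n \<omega> * V n \<omega> + A\<^sup>2 * (1 - I n \<omega>)) + (2 * \<gamma> n) * (I n \<omega> * (T n \<omega> \<bullet> \<xi> n \<omega>))"
      proof (cases "\<omega> \<in> stays A n")
        case False
        hence "\<omega> \<notin> stays A (Suc n)" by (auto simp: stays_def)
        thus ?thesis using False by (simp add: I_def)
      next
        case True
        have "I (Suc n) \<omega> * V (Suc n) \<omega> + A\<^sup>2 * (1 - I (Suc n) \<omega>) \<le> V (Suc n) \<omega>"
        proof (cases "\<omega> \<in> stays A (Suc n)")
          case False
          hence "norm (T (Suc n) \<omega>) > A" using True by (auto simp: stays_def le_Suc_eq)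
          hence "A\<^sup>2 \<le> (norm (T (Suc n) \<omega>))\<^sup>2" using A by (intro power_mono) auto
          thus ?thesis using False R[of "Suc n"] by (simp add: I_def V_def)
        qed (simp add: I_def)
        also have "\<dots> \<le> V n \<omega> + 2 * \<gamma> n * (T n \<omega> \<bullet> \<xi> n \<omega>)"
        proof -
          obtain c where c: "c > 0" "c * (norm (T n \<omega>))\<^sup>2 \<le> g n \<omega> \<bullet> T n \<omega>"
            using drift[OF A(1)] True n w by (fastforce simp: stays_def)
          hence "0 \<le> g n \<omega> \<bullet> T n \<omega>" by (meson less_imp_le mult_nonneg_nonneg order_trans zero_le_power2)
          hence "0 \<le> 2 * \<gamma> n * (g n \<omega> \<bullet> T n \<omega>)" using c\<^sub>0 by simp
          moreover have "R (Suc n) = R n - (\<gamma> n)\<^sup>2" using n by (simp add: R_def)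
          ultimately show ?thesis using norm_T_Suc_sq_le[OF n(1) w] unfolding V_def by linarith
        qed
        finally show ?thesis using True by (simp add: I_def)
      qed
    qed
    also have "\<dots> = expectation (\<lambda>\<omega>. I n \<omega> * V n \<omega> + A\<^sup>2 * (1 - I n \<omega>))"
      using noise_stays[OF n(1), of A]
      by (subst Bochner_Integration.integral_add[OF Jint[OF n(1)] integrable_mult_right]) (simp_all add: I_def)
    finally show ?case using step.IH by simp
  qed
  moreover have "A\<^sup>2 * (1 - prob (stays A n)) = expectation (\<lambda>\<omega>. A\<^sup>2 * (1 - I n \<omega>))"
  proof -
    have "expectation (\<lambda>\<omega>. A\<^sup>2 * (1 - I n \<omega>)) = A\<^sup>2 * (1 - expectation (I n))"
      using Iint[OF n] by (simp add: prob_space)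
    also have "expectation (I n) = prob (stays A n)"
      using stays_events[OF n] by (simp add: I_def[abs_def])
    finally show ?thesis by (rule sym)
  qed
  moreover have "\<dots> \<le> expectation (\<lambda>\<omega>. I n \<omega> * V n \<omega> + A\<^sup>2 * (1 - I n \<omega>))"
    using Iint[OF n] V by (intro integral_mono Jint[OF n]) (simp_all add: I_def[abs_def])
  ultimately show ?thesis by linarith
qed

text \<open>
Inside the ball the drift is coercive, so the second moment on \<open>stays A n\<close> is contracted by the factor
\<open>1 - 2 c \<gamma> n\<close> up to the squared gain. The events decrease with \<open>n\<close>, so passing from \<open>stays A n\<close> to
\<open>stays A (Suc n)\<close> can only lower the expectation.
\<close>
lemma second_moment_rate:
  assumes A: "A > 0"
  shows "\<exists>K\<ge>0. \<forall>n\<ge>1. expectation (\<lambda>\<omega>. indicator (stays A n) \<omega> * (norm (T n \<omega>))\<^sup>2) \<le> K * real n powr - \<alpha>"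
proof -
  obtain c where c: "c > 0" and dr: "\<And>n \<omega>. \<lbrakk>n \<ge> 1; \<omega> \<in> space M; norm (T n \<omega>) \<le> A\<rbrakk>
       \<Longrightarrow> c * (norm (T n \<omega>))\<^sup>2 \<le> g n \<omega> \<bullet> T n \<omega>"
    using drift[OF A] by blast
  define v where "v n = expectation (\<lambda>\<omega>. indicator (stays A n) \<omega> * (norm (T n \<omega>))\<^sup>2)" for n
  have "v (Suc n) \<le> (1 - 2 * c * c\<^sub>0 * real n powr - \<alpha>) * v n + c\<^sub>0\<^sup>2 * (real n powr - \<alpha>)\<^sup>2" if n: "n \<ge> 1" for n
  proof -
    have n': "Suc n \<ge> 1" by simp
    note int = integrable_stays_mult[OF n integrable_T_sq[OF n], of A]
    have "v (Suc n) \<le> expectation (\<lambda>\<omega>. (1 - 2 * c * \<gamma> n) * (indicator (stays A n) \<omega> * (norm (T n \<omega>))\<^sup>2)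
       + (2 * \<gamma> n) * (indicator (stays A n) \<omega> * (T n \<omega> \<bullet> \<xi> n \<omega>)) + (\<gamma> n)\<^sup>2)"
      unfolding v_def
    proof (rule integral_mono)
      show "integrable M (\<lambda>\<omega>. indicator (stays A (Suc n)) \<omega> * (norm (T (Suc n) \<omega>))\<^sup>2)"
        by (rule integrable_stays_mult[OF n' integrable_T_sq[OF n']])
      show "integrable M (\<lambda>\<omega>. (1 - 2 * c * \<gamma> n) * (indicator (stays A n) \<omega> * (norm (T n \<omega>))\<^sup>2)
         + (2 * \<gamma> n) * (indicator (stays A n) \<omega> * (T n \<omega> \<bullet> \<xi> n \<omega>)) + (\<gamma> n)\<^sup>2)"
        using int noise_stays(1)[OF n, of A] by simp
      fix \<omega> assume w: "\<omega> \<in> space M"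
      show "indicator (stays A (Suc n)) \<omega> * (norm (T (Suc n) \<omega>))\<^sup>2 \<le> (1 - 2 * c * \<gamma> n) * (indicator (stays A n) \<omega> * (norm (T n \<omega>))\<^sup>2)
         + (2 * \<gamma> n) * (indicator (stays A n) \<omega> * (T n \<omega> \<bullet> \<xi> n \<omega>)) + (\<gamma> n)\<^sup>2"
      proof (cases "\<omega> \<in> stays A n")
        case False
        hence "\<omega> \<notin> stays A (Suc n)" by (auto simp: stays_def)
        thus ?thesis using False by simp
      next
        case True
        have "indicator (stays A (Suc n)) \<omega> * (norm (T (Suc n) \<omega>))\<^sup>2 \<le> (norm (T (Suc n) \<omega>))\<^sup>2"
          by (simp add: indicator_def)
        also note norm_T_Suc_sq_le[OF n w]
        also have "(norm (T n \<omega>))\<^sup>2 + 2 * \<gamma> n * (T n \<omega> \<bullet> \<xi> n \<omega>) - 2 * \<gamma> n * (g n \<omega> \<bullet> T n \<omega>) + (\<gamma> n)\<^sup>2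
          \<le> (norm (T n \<omega>))\<^sup>2 + 2 * \<gamma> n * (T n \<omega> \<bullet> \<xi> n \<omega>) - 2 * \<gamma> n * (c * (norm (T n \<omega>))\<^sup>2) + (\<gamma> n)\<^sup>2"
          using dr[OF n w] True n c\<^sub>0 by (intro add_right_mono diff_left_mono mult_left_mono) (auto simp: stays_def)
        finally show ?thesis using True by (simp add: algebra_simps)
      qed
    qed
    also have "\<dots> = (1 - 2 * c * \<gamma> n) * v n + (\<gamma> n)\<^sup>2"
      using int noise_stays[OF n, of A] by (simp add: v_def prob_space)
    finally show ?thesis by (simp add: power_mult_distrib mult_ac)
  qed
  moreover have "v n \<ge> 0" for n unfolding v_def by (intro integral_nonneg_AE AE_I2) auto
  ultimately show ?thesis
    using powr_recursion_bound[of \<alpha> "2 * c * c\<^sub>0" "c\<^sub>0\<^sup>2" v] \<alpha> c c\<^sub>0 unfolding v_def by simp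
qed

lemma first_moment_rate:
  assumes A: "A > 0"
  shows "\<exists>K\<ge>0. \<forall>n\<ge>1. expectation (\<lambda>\<omega>. indicator (stays A n) \<omega> * norm (T n \<omega>)) \<le> K * real n powr (- \<alpha> / 2)"
proof -
  obtain K where K: "K \<ge> 0" "\<And>n. n \<ge> 1 \<Longrightarrow> 
     expectation (\<lambda>\<omega>. indicator (stays A n) \<omega> * (norm (T n \<omega>))\<^sup>2) \<le> K * real n powr - \<alpha>"
    using second_moment_rate[OF A] by auto
  have "expectation (\<lambda>\<omega>. indicator (stays A n) \<omega> * norm (T n \<omega>)) \<le> (K + 1) / 2 * real n powr (- \<alpha> / 2)"
    if n: "n \<ge> 1" for n
  proof -
    define s where "s = real n powr (- \<alpha> / 2)"
    have s: "s > 0" using n by (simp add: s_def)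
    have s2: "real n powr - \<alpha> = s * s" unfolding s_def powr_add[symmetric] by simp
    note int = integrable_stays_mult[OF n integrable_T_sq[OF n], of A]
    have "expectation (\<lambda>\<omega>. indicator (stays A n) \<omega> * norm (T n \<omega>))
      \<le> expectation (\<lambda>\<omega>. (1 / (2 * s)) * (indicator (stays A n) \<omega> * (norm (T n \<omega>))\<^sup>2) + s / 2)"
    proof (rule integral_mono')
      show "integrable M (\<lambda>\<omega>. (1 / (2 * s)) * (indicator (stays A n) \<omega> * (norm (T n \<omega>))\<^sup>2) + s / 2)"
        using int by (intro Bochner_Integration.integrable_add integrable_mult_right) auto
      fix \<omega>
      \<comment> \<open>the inequality of arithmetic and geometric means, balanced at the expected order \<open>s\<close> of the error\<close>
      have "0 \<le> (norm (T n \<omega>) - s)\<^sup>2 / (2 * s)" using s by simp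
      also have "\<dots> = (1 / (2 * s)) * (norm (T n \<omega>))\<^sup>2 + s / 2 - norm (T n \<omega>)"
        using s by (simp add: field_simps power2_eq_square)
      finally show "indicator (stays A n) \<omega> * norm (T n \<omega>)
         \<le> (1 / (2 * s)) * (indicator (stays A n) \<omega> * (norm (T n \<omega>))\<^sup>2) + s / 2"
        using s by (simp add: indicator_def)
      show "0 \<le> (1 / (2 * s)) * (indicator (stays A n) \<omega> * (norm (T n \<omega>))\<^sup>2) + s / 2"
        using s by simp
    qed
    also have "\<dots> = (1 / (2 * s)) * expectation (\<lambda>\<omega>. indicator (stays A n) \<omega> * (norm (T n \<omega>))\<^sup>2) + s / 2"
      using int by (subst Bochner_Integration.integral_add) (auto simp: prob_space)
    also have "\<dots> \<le> (1 / (2 * s)) * (K * (s * s)) + s / 2"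
      using K(2)[OF n] s unfolding s2 by (intro add_right_mono mult_left_mono) auto
    also have "\<dots> = (K + 1) / 2 * s" using s by (simp add: field_simps)
    finally show ?thesis by (simp add: s_def)
  qed
  thus ?thesis using K(1) by (intro exI[of _ "(K + 1) / 2"]) auto
qed

lemma summation_by_parts:
  fixes t :: "nat \<Rightarrow> 'a" and d :: "nat \<Rightarrow> real"
  shows "(\<Sum>k=1..n. d k *\<^sub>R (t k - t (Suc k)))
    = d 1 *\<^sub>R t 1 + (\<Sum>k=1..n. (d (Suc k) - d k) *\<^sub>R t (Suc k)) - d (Suc n) *\<^sub>R t (Suc n)"
  by (induction n) (simp_all add: algebra_simps)

text \<open>
With \<open>L\<close> a Taylor constant, this dominates the difference between \<open>n\<close> times the linearized averaged
error and the accumulated noise.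
\<close>
definition remainder :: "real \<Rightarrow> nat \<Rightarrow> 'w \<Rightarrow> real" where
  "remainder L n \<omega> = norm (\<Sum>k=1..n. (1 / \<gamma> k) *\<^sub>R (T k \<omega> - T (Suc k) \<omega>)) + L * (\<Sum>k=1..n. (norm (T k \<omega>))\<^sup>2)"

lemma integrable_T: assumes n: "n \<ge> 1" shows "integrable M (T n)"
proof -
  obtain K where "\<And>\<omega>. \<omega> \<in> space M \<Longrightarrow> norm (T n \<omega>) \<le> K"
    using norm_T_bound[of "n - 1"] n by auto
  thus ?thesis using T_measurable[OF n] by (intro integrable_bounded[of _ K])
qed

lemma integrable_remainder: "integrable M (remainder L n)"
  unfolding remainder_def[abs_def]
  by (intro Bochner_Integration.integrable_add integrable_norm integrable_mult_right
      Bochner_Integration.integrable_sum integrable_scaleR_right Bochner_Integration.integrable_diff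
      integrable_T integrable_T_sq) auto

lemma remainder_nonneg: "L \<ge> 0 \<Longrightarrow> remainder L n \<omega> \<ge> 0"
  unfolding remainder_def by (intro add_nonneg_nonneg mult_nonneg_nonneg sum_nonneg) auto

lemma inverse_gain: "1 / \<gamma> k = real k powr \<alpha> / c\<^sub>0"
  by (simp add: powr_minus field_simps)

text \<open>
Summation by parts trades the differences of consecutive errors, weighted by \<open>k^\<alpha>\<close>, for the errors
themselves, weighted by the increments of \<open>k^\<alpha>\<close>.
\<close>
lemma remainder_le:
  assumes "L \<ge> 0" "\<omega> \<in> stays A (Suc n)"
  shows "remainder L n \<omega> \<le> (1 / c\<^sub>0) * (norm (T 1 \<omega>)
      + (\<Sum>k=1..n. (real (Suc k) powr \<alpha> - real k powr \<alpha>) * norm (T (Suc k) \<omega>))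
      + real (Suc n) powr \<alpha> * norm (T (Suc n) \<omega>)) + L * (\<Sum>k=1..n. (norm (T k \<omega>))\<^sup>2)"
proof -
  define d where "d k = 1 / \<gamma> k" for k
  have d_diff: "\<bar>d (Suc k) - d k\<bar> = (real (Suc k) powr \<alpha> - real k powr \<alpha>) / c\<^sub>0" for k
  proof -
    have "real k powr \<alpha> \<le> real (Suc k) powr \<alpha>" using \<alpha> by (intro powr_mono2) auto
    thus ?thesis using c\<^sub>0 unfolding d_def inverse_gain by (simp add: diff_divide_distrib[symmetric])
  qed
  have "norm (\<Sum>k=1..n. d k *\<^sub>R (T k \<omega> - T (Suc k) \<omega>))
     \<le> norm (d 1 *\<^sub>R T 1 \<omega>) + norm (\<Sum>k=1..n. (d (Suc k) - d k) *\<^sub>R T (Suc k) \<omega>) + norm (d (Suc n) *\<^sub>R T (Suc n) \<omega>)"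
    unfolding summation_by_parts[of d "\<lambda>k. T k \<omega>" n]
    by (intro order_trans[OF norm_triangle_ineq4] add_right_mono norm_triangle_ineq)
  also have "norm (\<Sum>k=1..n. (d (Suc k) - d k) *\<^sub>R T (Suc k) \<omega>) \<le> (\<Sum>k=1..n. \<bar>d (Suc k) - d k\<bar> * norm (T (Suc k) \<omega>))"
    by (intro sum_norm_le) simp
  also have "\<dots> = (1 / c\<^sub>0) * (\<Sum>k=1..n. (real (Suc k) powr \<alpha> - real k powr \<alpha>) * norm (T (Suc k) \<omega>))"
    unfolding d_diff sum_distrib_left by (intro sum.cong) auto
  also have "norm (d 1 *\<^sub>R T 1 \<omega>) = (1 / c\<^sub>0) * norm (T 1 \<omega>)"
    using c\<^sub>0 by (simp add: d_def)
  also have "norm (d (Suc n) *\<^sub>R T (Suc n) \<omega>) = (1 / c\<^sub>0) * (real (Suc n) powr \<alpha> * norm (T (Suc n) \<omega>))"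
    using c\<^sub>0 unfolding d_def inverse_gain by simp
  finally show ?thesis
    unfolding remainder_def d_def by (simp only: distrib_left add_le_cancel_right)
qed

text \<open>
With first moments of order \<open>k^(-\<alpha>/2)\<close> on the events of confinement, the sum weighted by the increments of \<open>k^\<alpha>\<close> and the boundary term
are of order \<open>n^(\<alpha>/2)\<close>; the squares sum to order \<open>n^(1-\<alpha>)\<close>.
\<close>
lemma expectation_remainder:
  assumes A: "A > 0" and L: "L \<ge> 0"
  shows "\<exists>K\<ge>0. \<forall>n\<ge>1. expectation (\<lambda>\<omega>. indicator (stays A (Suc n)) \<omega> * remainder L n \<omega>)
    \<le> K * (1 + real (Suc n) powr (\<alpha> / 2) + real n powr (1 - \<alpha>))"
proof -
  obtain K2 where K2: "K2 \<ge> 0" "\<And>n. n \<ge> 1 \<Longrightarrow> 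
     expectation (\<lambda>\<omega>. indicator (stays A n) \<omega> * (norm (T n \<omega>))\<^sup>2) \<le> K2 * real n powr - \<alpha>"
    using second_moment_rate[OF A] by auto
  obtain K1 where K1: "K1 \<ge> 0" "\<And>n. n \<ge> 1 \<Longrightarrow> 
     expectation (\<lambda>\<omega>. indicator (stays A n) \<omega> * norm (T n \<omega>)) \<le> K1 * real n powr (- \<alpha> / 2)"
    using first_moment_rate[OF A] by auto
  define w where "w k = real (Suc k) powr \<alpha> - real k powr \<alpha>" for k
  have w: "w k \<ge> 0" for k unfolding w_def using \<alpha> powr_mono2[of \<alpha> "real k" "real (Suc k)"] by simp
  define e1 where "e1 k \<omega> = indicator (stays A k) \<omega> * norm (T k \<omega>)" for k \<omega>
  define e2 where "e2 k \<omega> = indicator (stays A k) \<omega> * (norm (T k \<omega>))\<^sup>2" for k \<omega>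
  have e1: "integrable M (e1 k)" "expectation (e1 k) \<le> K1 * real k powr (- \<alpha> / 2)" if "k \<ge> 1" for k
    using integrable_stays_mult[OF that integrable_norm[OF integrable_T[OF that]]] K1(2)[OF that]
    by (auto simp: e1_def[abs_def])
  have e2: "integrable M (e2 k)" "expectation (e2 k) \<le> K2 * real k powr - \<alpha>" if "k \<ge> 1" for k
    using integrable_stays_mult[OF that integrable_T_sq[OF that]] K2(2)[OF that]
    by (auto simp: e2_def[abs_def])
  define K where "K = K1 * 3 / c\<^sub>0 + K1 / c\<^sub>0 + L * (K2 / (1 - \<alpha>))"
  have K: "K \<ge> 0" using K1 K2 L c\<^sub>0 \<alpha> by (simp add: K_def)
  have "expectation (\<lambda>\<omega>. indicator (stays A (Suc n)) \<omega> * remainder L n \<omega>)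
    \<le> K * (1 + real (Suc n) powr (\<alpha> / 2) + real n powr (1 - \<alpha>))" if n: "n \<ge> 1" for n
  proof -
    define Y where "Y \<omega> = (1 / c\<^sub>0) * (e1 1 \<omega> + (\<Sum>k=1..n. w k * e1 (Suc k) \<omega>)
       + real (Suc n) powr \<alpha> * e1 (Suc n) \<omega>) + L * (\<Sum>k=1..n. e2 k \<omega>)" for \<omega>
    have e_nonneg: "e1 k \<omega> \<ge> 0" "e2 k \<omega> \<ge> 0" for k \<omega> by (auto simp: e1_def e2_def)
    have Ynn: "Y \<omega> \<ge> 0" for \<omega>
      unfolding Y_def using c\<^sub>0 L w e_nonneg
      by (intro add_nonneg_nonneg mult_nonneg_nonneg sum_nonneg) auto
    have "expectation (\<lambda>\<omega>. indicator (stays A (Suc n)) \<omega> * remainder L n \<omega>) \<le> expectation Y"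
    proof (rule integral_mono'[OF _ _ Ynn])
      show "integrable M Y" unfolding Y_def
        using e1(1) e2(1) by (intro Bochner_Integration.integrable_add integrable_mult_right Bochner_Integration.integrable_sum) auto
      fix \<omega>
      show "indicator (stays A (Suc n)) \<omega> * remainder L n \<omega> \<le> Y \<omega>"
      proof (cases "\<omega> \<in> stays A (Suc n)")
        case True
        have st: "\<omega> \<in> stays A k" if "k \<le> Suc n" for k
          using True stays_antimono[OF that] by blast
        have "remainder L n \<omega> \<le> Y \<omega>"
          using remainder_le[OF L True] st by (simp add: Y_def w_def e1_def e2_def)
        thus ?thesis using True by simp
      qed (use Ynn in simp)
    qed
    also have "expectation Y = (1 / c\<^sub>0) * (expectation (e1 1) + (\<Sum>k=1..n. w k * expectation (e1 (Suc k)))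
       + real (Suc n) powr \<alpha> * expectation (e1 (Suc n))) + L * (\<Sum>k=1..n. expectation (e2 k))"
    proof -
      define p where "p \<omega> = (\<Sum>k=1..n. w k * e1 (Suc k) \<omega>)" for \<omega>
      define q where "q \<omega> = (\<Sum>k=1..n. e2 k \<omega>)" for \<omega>
      have p: "integrable M p" "expectation p = (\<Sum>k=1..n. w k * expectation (e1 (Suc k)))"
        unfolding p_def[abs_def] using e1(1) by (auto simp: Bochner_Integration.integral_sum)
      have q: "integrable M q" "expectation q = (\<Sum>k=1..n. expectation (e2 k))"
        unfolding q_def[abs_def] using e2(1) by (auto simp: Bochner_Integration.integral_sum)
      have "expectation Y = expectation (\<lambda>\<omega>. (1 / c\<^sub>0) * (e1 1 \<omega> + p \<omega> + real (Suc n) powr \<alpha> * e1 (Suc n) \<omega>) + L * q \<omega>)"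
        by (simp add: Y_def[abs_def] p_def q_def)
      also have "\<dots> = (1 / c\<^sub>0) * (expectation (e1 1) + expectation p
          + real (Suc n) powr \<alpha> * expectation (e1 (Suc n))) + L * expectation q"
        using p(1) q(1) e1(1)[of 1] e1(1)[of "Suc n"]
        by (simp add: Bochner_Integration.integral_add del: of_nat_Suc)
      finally show ?thesis unfolding p(2) q(2) .
    qed
    also have "\<dots> \<le> (1 / c\<^sub>0) * (K1 + K1 * (2 * real (Suc n) powr (\<alpha> / 2)) + K1 * real (Suc n) powr (\<alpha> / 2))
       + L * (K2 * (real n powr (1 - \<alpha>) / (1 - \<alpha>)))"
    proof (intro add_mono mult_left_mono)
      show "expectation (e1 1) \<le> K1" using e1(2)[of 1] by simp
      have "(\<Sum>k=1..n. w k * expectation (e1 (Suc k))) \<le> (\<Sum>k=1..n. w k * (K1 * real (Suc k) powr (- \<alpha> / 2)))"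
        using w e1(2) by (intro sum_mono mult_left_mono) (auto simp del: of_nat_Suc)
      also have "\<dots> = K1 * (\<Sum>k=1..n. w k * real (Suc k) powr (- \<alpha> / 2))"
        by (simp add: sum_distrib_left mult_ac)
      also have "\<dots> \<le> K1 * (2 * real (Suc n) powr (\<alpha> / 2))"
        unfolding w_def using \<alpha> K1(1) by (intro mult_left_mono sum_powr_increments_le) auto
      finally show "(\<Sum>k=1..n. w k * expectation (e1 (Suc k))) \<le> K1 * (2 * real (Suc n) powr (\<alpha> / 2))" .
      have "real (Suc n) powr \<alpha> * expectation (e1 (Suc n)) \<le> real (Suc n) powr \<alpha> * (K1 * real (Suc n) powr (- \<alpha> / 2))"
        using e1(2)[of "Suc n"] by (intro mult_left_mono) auto
      also have "\<dots> = K1 * (real (Suc n) powr \<alpha> * real (Suc n) powr (- \<alpha> / 2))" by simp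
      also have "real (Suc n) powr \<alpha> * real (Suc n) powr (- \<alpha> / 2) = real (Suc n) powr (\<alpha> / 2)"
        unfolding powr_add[symmetric] by simp
      finally show "real (Suc n) powr \<alpha> * expectation (e1 (Suc n)) \<le> K1 * real (Suc n) powr (\<alpha> / 2)" .
      have "(\<Sum>k=1..n. expectation (e2 k)) \<le> (\<Sum>k=1..n. K2 * real k powr - \<alpha>)"
        using e2(2) by (intro sum_mono) auto
      also have "\<dots> = K2 * (\<Sum>k=1..n. real k powr - \<alpha>)" by (simp add: sum_distrib_left)
      also have "\<dots> \<le> K2 * (real n powr (1 - \<alpha>) / (1 - \<alpha>))"
        using \<alpha> K2(1) by (intro mult_left_mono sum_powr_minus_le) auto
      finally show "(\<Sum>k=1..n. expectation (e2 k)) \<le> K2 * (real n powr (1 - \<alpha>) / (1 - \<alpha>))" .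
    qed (use c\<^sub>0 L in auto)
    also have "\<dots> = (K1 / c\<^sub>0) * 1 + (K1 * 3 / c\<^sub>0) * real (Suc n) powr (\<alpha> / 2) + (L * (K2 / (1 - \<alpha>))) * real n powr (1 - \<alpha>)"
      by (simp add: add_divide_distrib algebra_simps)
    also have "\<dots> \<le> K * 1 + K * real (Suc n) powr (\<alpha> / 2) + K * real n powr (1 - \<alpha>)"
    proof -
      have "0 \<le> K1 * 3 / c\<^sub>0" "0 \<le> K1 / c\<^sub>0" "0 \<le> L * (K2 / (1 - \<alpha>))"
        using K1(1) K2(1) L c\<^sub>0 \<alpha> by simp_all
      hence "K1 / c\<^sub>0 \<le> K" "K1 * 3 / c\<^sub>0 \<le> K" "L * (K2 / (1 - \<alpha>)) \<le> K"
        unfolding K_def by linarith+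
      thus ?thesis by (intro add_mono mult_right_mono) auto
    qed
    finally show ?thesis by (simp add: distrib_left)
  qed
  with K show ?thesis by blast
qed

lemma sum_gain_sq_bounded: "\<exists>G. \<forall>n. (\<Sum>k=1..n. (\<gamma> k)\<^sup>2) \<le> G"
proof -
  have eq: "(\<gamma> k)\<^sup>2 = c\<^sub>0\<^sup>2 * real k powr (- (2 * \<alpha>))" for k
    by (simp add: power_mult_distrib power2_eq_square powr_add[symmetric])
  have "summable (\<lambda>k. (\<gamma> k)\<^sup>2)"
    unfolding eq using \<alpha> by (intro summable_mult) (simp add: summable_real_powr_iff)
  hence "(\<Sum>k=1..n. (\<gamma> k)\<^sup>2) \<le> (\<Sum>k. (\<gamma> k)\<^sup>2)" for n
    by (intro sum_le_suminf) auto
  thus ?thesis by blast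
qed

text \<open>
Both \<open>n^(\<alpha>/2)\<close> and \<open>n^(1-\<alpha>)\<close> are \<open>o(sqrt n)\<close>, the first because \<open>\<alpha> < 1\<close> and the second because
\<open>\<alpha> > 1/2\<close>. A large radius \<open>A\<close> makes leaving the ball improbable, and Markov's inequality is applied on
the event of staying inside.
\<close>
theorem remainder_negligible:
  assumes L: "L \<ge> 0" and \<epsilon>: "\<epsilon> > 0" and \<eta>: "\<eta> > 0"
  shows "\<exists>N. \<forall>n\<ge>N. prob {\<omega> \<in> space M. remainder L n \<omega> \<ge> \<epsilon> * sqrt (real n)} \<le> \<eta>"
proof -
  obtain G where G: "\<And>n. (\<Sum>k=1..n. (\<gamma> k)\<^sup>2) \<le> G" using sum_gain_sq_bounded by blast
  have G0: "G \<ge> 0" using G[of 0] by simp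
  \<comment> \<open>the radius for which \<open>prob_stays\<close> bounds the probability of leaving the ball by \<open>\<eta> / 2\<close>\<close>
  define A where "A = max B 1 + sqrt (2 * (B\<^sup>2 + G) / \<eta>)"
  have q: "0 \<le> 2 * (B\<^sup>2 + G) / \<eta>" using G0 \<eta> by simp
  have A: "A > 0" "B \<le> A" using real_sqrt_ge_zero[OF q] unfolding A_def by linarith+
  have "2 * (B\<^sup>2 + G) / \<eta> = (sqrt (2 * (B\<^sup>2 + G) / \<eta>))\<^sup>2" using q by simp
  also have "\<dots> \<le> A\<^sup>2" using q by (intro power_mono) (auto simp: A_def)
  finally have A2: "2 * (B\<^sup>2 + G) \<le> \<eta> * A\<^sup>2" using \<eta> by (simp add: field_simps)
  have leave: "1 - prob (stays A n) \<le> \<eta> / 2" if "n \<ge> 1" for n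
  proof -
    have "A\<^sup>2 * (1 - prob (stays A n)) \<le> A\<^sup>2 * (\<eta> / 2)"
      using prob_stays[OF A that G] A2 by (simp add: mult.commute)
    thus ?thesis using A(1) by (subst (asm) mult_le_cancel_left_pos) auto
  qed
  obtain K where K: "K \<ge> 0" "\<And>n. n \<ge> 1 \<Longrightarrow> expectation (\<lambda>\<omega>. indicator (stays A (Suc n)) \<omega> * remainder L n \<omega>)
    \<le> K * (1 + real (Suc n) powr (\<alpha> / 2) + real n powr (1 - \<alpha>))"
    using expectation_remainder[OF A(1) L] by auto
  have "(\<lambda>n. K * (1 + real (Suc n) powr (\<alpha> / 2) + real n powr (1 - \<alpha>)) / (\<epsilon> * sqrt (real n))) \<longlonglongrightarrow> 0"
  proof (rule tendsto_sandwich[of "\<lambda>_. 0"])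
    have lim: "(\<lambda>n::nat. real n powr s) \<longlonglongrightarrow> 0" if "s < 0" for s
      using that by (intro tendsto_neg_powr filterlim_real_sequentially)
    have "(\<lambda>n::nat. (K / \<epsilon>) * (real n powr (- (1/2)) + 2 * real n powr (\<alpha> / 2 - 1/2) + real n powr (1/2 - \<alpha>)))
        \<longlonglongrightarrow> (K / \<epsilon>) * (0 + 2 * 0 + 0)"
      using \<alpha> by (intro tendsto_intros lim) auto
    thus "(\<lambda>n::nat. (K / \<epsilon>) * (real n powr (- (1/2)) + 2 * real n powr (\<alpha> / 2 - 1/2) + real n powr (1/2 - \<alpha>))) \<longlonglongrightarrow> 0"
      by simp
    show "\<forall>\<^sub>F n in sequentially. 0 \<le> K * (1 + real (Suc n) powr (\<alpha> / 2) + real n powr (1 - \<alpha>)) / (\<epsilon> * sqrt (real n))"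
      using K(1) \<epsilon> by simp
    show "\<forall>\<^sub>F n in sequentially. K * (1 + real (Suc n) powr (\<alpha> / 2) + real n powr (1 - \<alpha>)) / (\<epsilon> * sqrt (real n))
        \<le> (K / \<epsilon>) * (real n powr (- (1/2)) + 2 * real n powr (\<alpha> / 2 - 1/2) + real n powr (1/2 - \<alpha>))"
      using eventually_ge_at_top[of 1]
    proof eventually_elim
      case (elim n)
      define r where "r = real n powr (1/2)"
      have r: "r > 0" "sqrt (real n) = r" using elim by (simp_all add: r_def powr_half_sqrt)
      have "real (Suc n) powr (\<alpha> / 2) \<le> (2 * real n) powr (\<alpha> / 2)"
        using elim \<alpha> by (intro powr_mono2) auto
      also have "\<dots> = 2 powr (\<alpha> / 2) * real n powr (\<alpha> / 2)" by (simp add: powr_mult)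
      also have "(2::real) powr (\<alpha> / 2) \<le> 2 powr 1" using \<alpha> by (intro powr_mono) auto
      finally have "real (Suc n) powr (\<alpha> / 2) \<le> 2 * real n powr (\<alpha> / 2)"
        by (simp add: mult_right_mono)
      hence "K * (1 + real (Suc n) powr (\<alpha> / 2) + real n powr (1 - \<alpha>)) / (\<epsilon> * r)
          \<le> K * (1 + 2 * real n powr (\<alpha> / 2) + real n powr (1 - \<alpha>)) / (\<epsilon> * r)"
        using K(1) \<epsilon> r by (intro divide_right_mono mult_left_mono add_mono) auto
      also have "\<dots> = (K / \<epsilon>) * (1 / r + 2 * (real n powr (\<alpha> / 2) / r) + real n powr (1 - \<alpha>) / r)"
        using \<epsilon> r by (simp add: field_simps)
      also have "1 / r = real n powr (- (1/2))"
        unfolding r_def by (rule powr_minus_divide[symmetric])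
      also have "real n powr (\<alpha> / 2) / r = real n powr (\<alpha> / 2 - 1/2)"
        unfolding r_def by (rule powr_diff[symmetric])
      also have "real n powr (1 - \<alpha>) / r = real n powr (1/2 - \<alpha>)"
        unfolding r_def powr_diff[symmetric] by simp
      finally show ?case using r by simp
    qed
  qed simp
  from order_tendstoD(2)[OF this, of "\<eta> / 2"] \<eta>
  obtain N where N: "\<And>n. n \<ge> N \<Longrightarrow> K * (1 + real (Suc n) powr (\<alpha> / 2) + real n powr (1 - \<alpha>)) / (\<epsilon> * sqrt (real n)) < \<eta> / 2"
    by (auto simp: eventually_sequentially)
  have "prob {\<omega> \<in> space M. remainder L n \<omega> \<ge> \<epsilon> * sqrt (real n)} \<le> \<eta>" if n: "n \<ge> max N 1" for n
  proof -
    have n1: "n \<ge> 1" "n \<ge> N" "Suc n \<ge> 1" using n by auto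
    define Y where "Y \<omega> = indicator (stays A (Suc n)) \<omega> * remainder L n \<omega>" for \<omega>
    have Yint: "integrable M Y"
      using integrable_stays_mult[OF n1(3) integrable_remainder] by (simp add: Y_def[abs_def])
    have ev: "{\<omega> \<in> space M. Y \<omega> \<ge> \<epsilon> * sqrt (real n)} \<in> events"
      using Yint by measurable
    have "prob {\<omega> \<in> space M. remainder L n \<omega> \<ge> \<epsilon> * sqrt (real n)}
      \<le> prob ({\<omega> \<in> space M. Y \<omega> \<ge> \<epsilon> * sqrt (real n)} \<union> (space M - stays A (Suc n)))"
      using ev stays_events[OF n1(3)] by (intro finite_measure_mono) (auto simp: Y_def)
    also have "\<dots> \<le> prob {\<omega> \<in> space M. Y \<omega> \<ge> \<epsilon> * sqrt (real n)} + prob (space M - stays A (Suc n))"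
      using ev stays_events[OF n1(3)] by (intro measure_Un_le) auto
    also have "prob (space M - stays A (Suc n)) \<le> \<eta> / 2"
      using leave[OF n1(3)] prob_compl[OF stays_events[OF n1(3), of A]] by simp
    also have "prob {\<omega> \<in> space M. Y \<omega> \<ge> \<epsilon> * sqrt (real n)} \<le> expectation Y / (\<epsilon> * sqrt (real n))"
      using \<epsilon> n1 remainder_nonneg[OF L]
      by (intro integral_Markov_inequality_measure[OF Yint, of "{}"]) (auto simp: Y_def)
    also have "\<dots> \<le> K * (1 + real (Suc n) powr (\<alpha> / 2) + real n powr (1 - \<alpha>)) / (\<epsilon> * sqrt (real n))"
      using K(2)[OF n1(1)] \<epsilon> unfolding Y_def by (intro divide_right_mono) auto
    also have "\<dots> \<le> \<eta> / 2" using N[OF n1(2)] by simp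
    finally show ?thesis by simp
  qed
  thus ?thesis by blast
qed

end

section \<open>Independence of the next observation from the past\<close>

locale independent_sequence = prob_space M for M :: "'w measure" +
  fixes Xs :: "nat \<Rightarrow> 'w \<Rightarrow> 'b::{second_countable_topology, topological_space}"
  assumes indep: "indep_vars (\<lambda>_. borel) Xs {1..}"
begin

text \<open>The sigma-algebra generated by the first \<open>n\<close> variables.\<close>
definition past :: "nat \<Rightarrow> 'w measure" where
  "past n = vimage_algebra (space M) (\<lambda>\<omega>. \<lambda>i\<in>{1..n}. Xs i \<omega>) (PiM {1..n} (\<lambda>_. borel))"

lemma Xs_measurable: "n \<ge> 1 \<Longrightarrow> Xs n \<in> borel_measurable M"
  using indep by (auto simp: indep_vars_def)

lemma space_past [simp]: "space (past n) = space M"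
  by (simp add: past_def)

lemma past_tuple_measurable:
  "(\<lambda>\<omega>. \<lambda>i\<in>{1..n}. Xs i \<omega>) \<in> measurable (past n) (PiM {1..n} (\<lambda>_. borel))"
  unfolding past_def by (intro measurable_vimage_algebra1) (auto simp: space_PiM)

lemma Xs_past: "1 \<le> i \<Longrightarrow> i \<le> n \<Longrightarrow> Xs i \<in> borel_measurable (past n)"
  using measurable_compose[OF past_tuple_measurable measurable_component_singleton, of i n] by simp

lemma past_le:
  assumes sp: "space N = space M" and "\<And>i. 1 \<le> i \<Longrightarrow> i \<le> n \<Longrightarrow> Xs i \<in> borel_measurable N"
  shows "subalgebra N (past n)"
proof -
  have "(\<lambda>\<omega>. \<lambda>i\<in>{1..n}. Xs i \<omega>) \<in> measurable N (PiM {1..n} (\<lambda>_. borel))"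
    using assms by (intro measurable_restrict) auto
  from sets_image_in_sets[OF sp this]
  show ?thesis using sp by (simp add: subalgebra_def past_def)
qed

lemma subalgebra_past: "subalgebra M (past n)"
  by (rule past_le) (auto intro: Xs_measurable)

lemma past_mono: "subalgebra (past (Suc n)) (past n)"
  by (rule past_le) (auto intro: Xs_past)

lemma prob_past_Int:
  assumes A: "A \<in> sets (past n)" and B: "B \<in> sets borel"
  shows "prob (A \<inter> (Xs (Suc n) -` B \<inter> space M)) = prob A * prob (Xs (Suc n) -` B \<inter> space M)"
proof -
  define p where "p \<omega> = (\<lambda>i\<in>{1..n}. Xs i \<omega>)" for \<omega>
  define q where "q \<omega> = (\<lambda>i\<in>{Suc n}. Xs i \<omega>)" for \<omega>
  define B' where "B' = (\<lambda>f. f (Suc n)) -` B \<inter> space (PiM {Suc n} (\<lambda>_. borel :: 'b measure))"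
  obtain A' where A': "A' \<in> sets (PiM {1..n} (\<lambda>_. borel))" "A = p -` A' \<inter> space M"
    using A unfolding past_def p_def by (subst (asm) sets_vimage_algebra2) (auto simp: space_PiM)
  have B': "B' \<in> sets (PiM {Suc n} (\<lambda>_. borel))"
    unfolding B'_def by (intro measurable_sets[OF _ B] measurable_component_singleton) simp
  have Beq: "Xs (Suc n) -` B \<inter> space M = q -` B' \<inter> space M"
    by (auto simp: B'_def q_def space_PiM)
  have "indep_var (PiM {1..n} (\<lambda>_. borel)) p (PiM {Suc n} (\<lambda>_. borel)) q"
    unfolding p_def q_def by (rule indep_var_restrict[OF indep]) auto
  from indep_varD[OF this A'(1) B'] show ?thesis
    unfolding A'(2) Beq by (simp add: vimage_def Int_def conj_ac)
qed

text \<open>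
A variable of the past may be treated as a constant when averaging over the next observation. By
independence the joint law of the identity map into \<open>past n\<close> and of the next observation is a product
measure, and Fubini's theorem applies to it.
\<close>
lemma expectation_freeze_past:
  fixes h :: "'w \<Rightarrow> 'b \<Rightarrow> real"
  assumes h: "(\<lambda>(\<omega>, x). h \<omega> x) \<in> borel_measurable (past n \<Otimes>\<^sub>M borel)"
    and bound: "\<And>\<omega> x. \<omega> \<in> space M \<Longrightarrow> \<bar>h \<omega> x\<bar> \<le> B"
  shows "expectation (\<lambda>\<omega>. h \<omega> (Xs (Suc n) \<omega>)) = expectation (\<lambda>\<omega>. \<integral>x. h \<omega> x \<partial>distr M borel (Xs (Suc n)))"
proof -
  let ?P = "distr M (past n) (\<lambda>\<omega>. \<omega>)" and ?Q = "distr M borel (Xs (Suc n))"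
  have id: "(\<lambda>\<omega>. \<omega>) \<in> measurable M (past n)"
  proof (rule measurableI)
    show "(\<lambda>\<omega>. \<omega>) -` A \<inter> space M \<in> events" if "A \<in> sets (past n)" for A
      using that subalgebra_past[of n] by (auto simp: subalgebra_def)
  qed simp
  have X: "Xs (Suc n) \<in> borel_measurable M" by (rule Xs_measurable) simp
  have pair: "(\<lambda>\<omega>. (\<omega>, Xs (Suc n) \<omega>)) \<in> measurable M (past n \<Otimes>\<^sub>M borel)"
    by (rule measurable_Pair[OF id X])
  interpret P: prob_space ?P by (rule prob_space_distr[OF id])
  interpret Q: prob_space ?Q by (rule prob_space_distr[OF X])
  interpret PQ: pair_prob_space ?P ?Q ..
  have eq: "?P \<Otimes>\<^sub>M ?Q = distr M (past n \<Otimes>\<^sub>M borel) (\<lambda>\<omega>. (\<omega>, Xs (Suc n) \<omega>))"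
  proof (rule pair_measure_eqI[OF P.sigma_finite_measure_axioms Q.sigma_finite_measure_axioms])
    fix A B assume "A \<in> sets ?P" "B \<in> sets ?Q"
    hence A: "A \<in> sets (past n)" and B: "B \<in> sets borel" by simp_all
    have "A \<subseteq> space M" using sets.sets_into_space[OF A] by simp
    hence 1: "A \<inter> space M = A"
      and 2: "(\<lambda>\<omega>. (\<omega>, Xs (Suc n) \<omega>)) -` (A \<times> B) \<inter> space M = A \<inter> (Xs (Suc n) -` B \<inter> space M)"
      by auto
    have "emeasure ?P A * emeasure ?Q B = ennreal (prob A * prob (Xs (Suc n) -` B \<inter> space M))"
      using A B id X by (simp add: emeasure_distr 1 emeasure_eq_measure ennreal_mult'')
    also have "\<dots> = emeasure (distr M (past n \<Otimes>\<^sub>M borel) (\<lambda>\<omega>. (\<omega>, Xs (Suc n) \<omega>))) (A \<times> B)"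
      using A B pair by (simp add: emeasure_distr 2 emeasure_eq_measure prob_past_Int)
    finally show "emeasure ?P A * emeasure ?Q B = emeasure (distr M (past n \<Otimes>\<^sub>M borel) (\<lambda>\<omega>. (\<omega>, Xs (Suc n) \<omega>))) (A \<times> B)" .
  qed (auto cong: sets_pair_measure_cong)
  have h': "(\<lambda>(\<omega>, x). h \<omega> x) \<in> borel_measurable (?P \<Otimes>\<^sub>M ?Q)"
    using h by (simp cong: measurable_cong_sets)
  have int: "integrable (?P \<Otimes>\<^sub>M ?Q) (\<lambda>(\<omega>, x). h \<omega> x)"
    using bound by (intro PQ.integrable_const_bound[of _ B] AE_I2 h') (auto simp: space_pair_measure)
  have "expectation (\<lambda>\<omega>. h \<omega> (Xs (Suc n) \<omega>)) = (\<integral>z. (case z of (\<omega>, x) \<Rightarrow> h \<omega> x) \<partial>(?P \<Otimes>\<^sub>M ?Q))"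
    unfolding eq by (subst integral_distr[OF pair h]) simp
  also have "\<dots> = (\<integral>\<omega>. (\<integral>x. h \<omega> x \<partial>?Q) \<partial>?P)"
    using PQ.integral_fst'[OF int] by simp
  also have "\<dots> = expectation (\<lambda>\<omega>. \<integral>x. h \<omega> x \<partial>?Q)"
  proof (rule integral_distr[OF id])
    have "(\<lambda>\<omega>. \<integral>x. h \<omega> x \<partial>?Q) \<in> borel_measurable ?P"
      by (rule Q.borel_measurable_lebesgue_integral[OF h'])
    thus "(\<lambda>\<omega>. \<integral>x. h \<omega> x \<partial>?Q) \<in> borel_measurable (past n)"
      by (simp cong: measurable_cong_sets)
  qed
  finally show ?thesis .
qed

end

section \<open>The averaged median recursion\<close>

locale median_recursion = hilbert_median M X C m + independent_sequence M Xs
  for M :: "'w measure" and X :: "'w \<Rightarrow> 'a::{real_inner, banach, second_countable_topology}"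
    and C m and Xs :: "nat \<Rightarrow> 'w \<Rightarrow> 'a" +
  fixes Z :: "nat \<Rightarrow> 'w \<Rightarrow> 'a" and \<alpha> c\<^sub>0 B :: real
  assumes copies: "n \<ge> 1 \<Longrightarrow> distr M borel (Xs n) = distr M borel X"
    and \<alpha>: "1/2 < \<alpha>" "\<alpha> < 1" and c\<^sub>0: "c\<^sub>0 > 0"
    and Z1_measurable: "Z 1 \<in> borel_measurable (past 1)"
    and Z1_bound: "\<omega> \<in> space M \<Longrightarrow> norm (Z 1 \<omega> - m) \<le> B"
    and Z_Suc: "\<lbrakk>n \<ge> 1; \<omega> \<in> space M\<rbrakk> \<Longrightarrow>
       Z (Suc n) \<omega> = Z n \<omega> + (c\<^sub>0 * real n powr - \<alpha>) *\<^sub>R sgn (Xs (Suc n) \<omega> - Z n \<omega>)"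
begin

definition noise :: "nat \<Rightarrow> 'w \<Rightarrow> 'a" where
  "noise n \<omega> = sgn (Xs (Suc n) \<omega> - Z n \<omega>) + grad (Z n \<omega>)"

lemma Z_adapted: "n \<ge> 1 \<Longrightarrow> Z n \<in> borel_measurable (past n)"
proof (induction n rule: dec_induct)
  case (step n)
  have [measurable]: "Z n \<in> borel_measurable (past (Suc n))"
    by (rule measurable_from_subalg[OF past_mono step.IH])
  have [measurable]: "Xs (Suc n) \<in> borel_measurable (past (Suc n))"
    by (rule Xs_past) auto
  have "(\<lambda>\<omega>. Z n \<omega> + (c\<^sub>0 * real n powr - \<alpha>) *\<^sub>R sgn (Xs (Suc n) \<omega> - Z n \<omega>)) \<in> borel_measurable (past (Suc n))"
    by measurable
  also have "?this \<longleftrightarrow> ?case"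
    using Z_Suc[OF step(1)] by (intro measurable_cong) simp
  finally show ?case .
qed (rule Z1_measurable)

lemma expectation_inner_sgn:
  "expectation (\<lambda>\<omega>'. w \<bullet> sgn (X \<omega>' - z)) = - (w \<bullet> grad z)"
  by (simp add: grad_def)

text \<open>
Freezing the past at \<open>\<omega>\<close>, the average of \<open>sgn (X - Z n \<omega>)\<close> over a fresh copy of \<open>X\<close> is
\<open>- grad (Z n \<omega>)\<close>.
\<close>
lemma noise_centred:
  assumes n: "n \<ge> 1" and W: "W \<in> borel_measurable (past n)"
    and bound: "\<And>\<omega>. \<omega> \<in> space M \<Longrightarrow> norm (W \<omega>) \<le> K"
  shows "expectation (\<lambda>\<omega>. W \<omega> \<bullet> noise n \<omega>) = 0"
proof -
  note [measurable] = W Z_adapted[OF n]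
  have W_M [measurable]: "W \<in> borel_measurable M" and Z_M [measurable]: "Z n \<in> borel_measurable M"
    and Xs_M [measurable]: "Xs (Suc n) \<in> borel_measurable M"
    by (rule measurable_from_subalg[OF subalgebra_past W],
        rule measurable_from_subalg[OF subalgebra_past Z_adapted[OF n]], rule Xs_measurable) simp
  have le: "\<bar>W \<omega> \<bullet> v\<bar> \<le> K" if "\<omega> \<in> space M" "norm v \<le> 1" for \<omega> v
    using Cauchy_Schwarz_ineq2[of "W \<omega>" v] mult_mono[OF bound[OF that(1)] that(2)]
      order_trans[OF norm_ge_zero bound[OF that(1)]] by simp
  have sgn_le: "norm (sgn v) \<le> 1" for v :: 'a by (simp add: norm_sgn)
  have int1: "integrable M (\<lambda>\<omega>. W \<omega> \<bullet> sgn (Xs (Suc n) \<omega> - Z n \<omega>))"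
    using le[OF _ sgn_le] by (intro integrable_const_bound[of _ K] AE_I2) auto
  have int2: "integrable M (\<lambda>\<omega>. W \<omega> \<bullet> grad (Z n \<omega>))"
    using le[OF _ norm_grad_le] by (intro integrable_const_bound[of _ K] AE_I2) auto
  have "expectation (\<lambda>\<omega>. W \<omega> \<bullet> sgn (Xs (Suc n) \<omega> - Z n \<omega>))
      = expectation (\<lambda>\<omega>. \<integral>x. W \<omega> \<bullet> sgn (x - Z n \<omega>) \<partial>distr M borel (Xs (Suc n)))"
  proof (rule expectation_freeze_past)
    show "(\<lambda>(\<omega>, x). W \<omega> \<bullet> sgn (x - Z n \<omega>)) \<in> borel_measurable (past n \<Otimes>\<^sub>M borel)"
      by measurable
  qed (rule le[OF _ sgn_le])
  also have "\<dots> = expectation (\<lambda>\<omega>. - (W \<omega> \<bullet> grad (Z n \<omega>)))"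
  proof (rule Bochner_Integration.integral_cong[OF refl])
    fix \<omega>
    have "(\<integral>x. W \<omega> \<bullet> sgn (x - Z n \<omega>) \<partial>distr M borel (Xs (Suc n)))
        = expectation (\<lambda>\<omega>'. W \<omega> \<bullet> sgn (X \<omega>' - Z n \<omega>))"
      by (subst copies, simp, subst integral_distr) auto
    thus "(\<integral>x. W \<omega> \<bullet> sgn (x - Z n \<omega>) \<partial>distr M borel (Xs (Suc n))) = - (W \<omega> \<bullet> grad (Z n \<omega>))"
      by (simp only: expectation_inner_sgn)
  qed
  finally show ?thesis
    unfolding noise_def inner_add_right using int1 int2 by simp
qed

sublocale robbins_monro M past noise 2 "\<lambda>n \<omega>. Z n \<omega> - m" "\<lambda>n \<omega>. grad (Z n \<omega>)" \<alpha> c\<^sub>0 B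
proof
  show "subalgebra M (past n)" "subalgebra (past (Suc n)) (past n)" for n
    by (rule subalgebra_past, rule past_mono)
  show "noise n \<in> borel_measurable (past (Suc n))" if n: "n \<ge> 1" for n
  proof -
    have [measurable]: "Z n \<in> borel_measurable (past (Suc n))" "Xs (Suc n) \<in> borel_measurable (past (Suc n))"
      using measurable_from_subalg[OF past_mono Z_adapted[OF n]] Xs_past[of "Suc n" "Suc n"] by auto
    show ?thesis unfolding noise_def[abs_def] by measurable
  qed
  show "norm (noise n \<omega>) \<le> 2" for n \<omega>
    unfolding noise_def using norm_triangle_ineq[of "sgn (Xs (Suc n) \<omega> - Z n \<omega>)" "grad (Z n \<omega>)"]
      norm_grad_le[of "Z n \<omega>"] by (simp add: norm_sgn split: if_splits)
  show "expectation (\<lambda>\<omega>. W \<omega> \<bullet> noise n \<omega>) = 0"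
    if "n \<ge> 1" "W \<in> borel_measurable (past n)" "\<And>\<omega>. \<omega> \<in> space M \<Longrightarrow> norm (W \<omega>) \<le> K" for n W K
    by (rule noise_centred[OF that])
  show "(\<lambda>\<omega>. Z n \<omega> - m) \<in> borel_measurable (past n)" if "n \<ge> 1" for n
    using Z_adapted[OF that] by simp
  show "norm (Z 1 \<omega> - m) \<le> B" if "\<omega> \<in> space M" for \<omega> by (rule Z1_bound[OF that])
  show "Z (Suc n) \<omega> - m = Z n \<omega> - m + (c\<^sub>0 * real n powr - \<alpha>) *\<^sub>R (noise n \<omega> - grad (Z n \<omega>))"
    if "n \<ge> 1" "\<omega> \<in> space M" for n \<omega>
    using Z_Suc[OF that] by (simp add: noise_def)
  show "norm (noise n \<omega> - grad (Z n \<omega>)) \<le> 1" for n \<omega> by (simp add: noise_def norm_sgn)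
  show "\<exists>c>0. \<forall>n\<ge>1. \<forall>\<omega>\<in>space M. norm (Z n \<omega> - m) \<le> A \<longrightarrow> c * (norm (Z n \<omega> - m))\<^sup>2 \<le> grad (Z n \<omega>) \<bullet> (Z n \<omega> - m)"
    if "A > 0" for A
    using grad_strongly_monotone[OF that] by blast
qed (use \<alpha> c\<^sub>0 in auto)

text \<open>
The decomposition on which everything rests: \<open>grad (Z k)\<close> is both the linearization \<open>\<Gamma> (Z k - m)\<close> up to a
quadratic error and, by the recursion, the noise minus the normalized step. Summation over \<open>k\<close> leaves a
martingale and the remainder of the Robbins-Monro scheme.
\<close>
lemma norm_Gamma_avg_le:
  assumes n: "n \<ge> 1" and w: "\<omega> \<in> space M"
  shows "real n * norm (Gamma_op M X m (avg_seq Z n \<omega> - m)) \<le> norm (noise_sum n \<omega>) + remainder (10 * C) n \<omega>"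
proof -
  interpret \<Gamma>: bounded_linear "Gamma_op M X m" by (rule bounded_linear_Gamma)
  let ?\<Gamma> = "Gamma_op M X m"
  define \<delta> where "\<delta> k = grad (Z k \<omega>) - ?\<Gamma> (Z k \<omega> - m)" for k
  have "real n *\<^sub>R (avg_seq Z n \<omega> - m) = (\<Sum>k=1..n. Z k \<omega> - m)"
    using n by (simp add: avg_seq_def scaleR_diff_right sum_subtractf sum_constant_scaleR)
  hence "real n *\<^sub>R ?\<Gamma> (avg_seq Z n \<omega> - m) = (\<Sum>k=1..n. ?\<Gamma> (Z k \<omega> - m))"
    by (metis \<Gamma>.scaleR \<Gamma>.sum)
  also have "\<dots> = (\<Sum>k=1..n. noise k \<omega> + (1 / \<gamma> k) *\<^sub>R ((Z k \<omega> - m) - (Z (Suc k) \<omega> - m)) - \<delta> k)"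
  proof (rule sum.cong[OF refl])
    fix k assume "k \<in> {1..n}"
    hence k: "k \<ge> 1" by simp
    have "(1 / \<gamma> k) *\<^sub>R ((Z k \<omega> - m) - (Z (Suc k) \<omega> - m)) = - sgn (Xs (Suc k) \<omega> - Z k \<omega>)"
      using k c\<^sub>0 by (simp add: Z_Suc[OF k w])
    thus "?\<Gamma> (Z k \<omega> - m) = noise k \<omega> + (1 / \<gamma> k) *\<^sub>R ((Z k \<omega> - m) - (Z (Suc k) \<omega> - m)) - \<delta> k"
      by (simp only: noise_def \<delta>_def) simp
  qed
  also have "\<dots> = noise_sum n \<omega> + (\<Sum>k=1..n. (1 / \<gamma> k) *\<^sub>R ((Z k \<omega> - m) - (Z (Suc k) \<omega> - m))) - (\<Sum>k=1..n. \<delta> k)"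
    by (simp only: noise_sum_def sum.distrib sum_subtractf)
  finally have "real n * norm (?\<Gamma> (avg_seq Z n \<omega> - m))
     = norm (noise_sum n \<omega> + (\<Sum>k=1..n. (1 / \<gamma> k) *\<^sub>R ((Z k \<omega> - m) - (Z (Suc k) \<omega> - m))) - (\<Sum>k=1..n. \<delta> k))"
    by (metis norm_scaleR abs_of_nat)
  also have "\<dots> \<le> norm (noise_sum n \<omega>) + norm (\<Sum>k=1..n. (1 / \<gamma> k) *\<^sub>R ((Z k \<omega> - m) - (Z (Suc k) \<omega> - m))) + norm (\<Sum>k=1..n. \<delta> k)"
    by (intro order_trans[OF norm_triangle_ineq4] add_right_mono norm_triangle_ineq)
  also have "norm (\<Sum>k=1..n. \<delta> k) \<le> (\<Sum>k=1..n. 10 * C * (norm (Z k \<omega> - m))\<^sup>2)"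
  proof (rule sum_norm_le)
    fix k show "norm (\<delta> k) \<le> 10 * C * (norm (Z k \<omega> - m))\<^sup>2"
      using grad_taylor[of "Z k \<omega> - m"] by (simp add: \<delta>_def)
  qed
  also have "\<dots> = 10 * C * (\<Sum>k=1..n. (norm (Z k \<omega> - m))\<^sup>2)"
    by (rule sum_distrib_left[symmetric])
  finally show ?thesis by (simp only: remainder_def add.assoc)
qed

text \<open>
Of the allowed deviation \<open>4 sqrt n ln (4 / \<delta>)\<close> of the sum, three quarters go to the martingale and one
quarter to the remainder. The part \<open>2 / (3 n)\<close> of the radius only enlarges the ball.
\<close>
theorem confidence_ball:
  assumes \<delta>: "0 < \<delta>" "\<delta> < 1"
  shows "\<exists>N. \<forall>n\<ge>N. prob {\<omega> \<in> space M. norm (Gamma_op M X m (avg_seq Z n \<omega> - m))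
        \<le> 4 * (2 / (3 * real n) + 1 / sqrt (real n)) * ln (4 / \<delta>)} \<ge> 1 - \<delta>"
proof -
  define L where "L = ln (4 / \<delta>)"
  have "4 \<le> 4 / \<delta>" using \<delta> by (simp add: field_simps)
  hence "exp 1 \<le> 4 / \<delta>" using exp_le by linarith
  hence L: "L \<ge> 1" unfolding L_def using \<delta> by (subst ln_ge_iff) auto
  obtain N where N: "\<And>n. n \<ge> N \<Longrightarrow>
      prob {\<omega> \<in> space M. remainder (10 * C) n \<omega> \<ge> L * sqrt (real n)} \<le> \<delta> / 2"
    using remainder_negligible[of "10 * C" L "\<delta> / 2"] C_pos L \<delta> by auto
  have "prob {\<omega> \<in> space M. norm (Gamma_op M X m (avg_seq Z n \<omega> - m))
        \<le> 4 * (2 / (3 * real n) + 1 / sqrt (real n)) * L} \<ge> 1 - \<delta>" (is "prob ?good \<ge> _")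
    if nN: "n \<ge> max N 1" for n
  proof -
    have n: "n \<ge> 1" "n \<ge> N" using nN by auto
    define E1 where "E1 = {\<omega> \<in> space M. norm (noise_sum n \<omega>) \<ge> 3 * L * sqrt (real n)}"
    define E2 where "E2 = {\<omega> \<in> space M. remainder (10 * C) n \<omega> \<ge> L * sqrt (real n)}"
    have Zk [measurable]: "Z k \<in> borel_measurable M" if "k \<in> {1..n}" for k
      using measurable_from_subalg[OF subalgebra_past Z_adapted] that by auto
    have "(\<lambda>\<omega>. avg_seq Z n \<omega>) \<in> borel_measurable M"
      unfolding avg_seq_def by (intro borel_measurable_scaleR borel_measurable_sum borel_measurable_const Zk)
    moreover have "Gamma_op M X m \<in> borel_measurable borel"
      by (intro borel_measurable_continuous_onI linear_continuous_on bounded_linear_Gamma)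
    ultimately have [measurable]: "(\<lambda>\<omega>. Gamma_op M X m (avg_seq Z n \<omega> - m)) \<in> borel_measurable M"
      by measurable
    have [measurable]: "noise_sum n \<in> borel_measurable M" by (rule measurable_from_F[OF noise_sum_adapted])
    have [measurable]: "remainder (10 * C) n \<in> borel_measurable M" using integrable_remainder by auto
    have good: "?good \<in> events" by measurable
    have E: "E1 \<in> events" "E2 \<in> events" unfolding E1_def E2_def by measurable
    have "space M - ?good \<subseteq> E1 \<union> E2"
    proof
      fix \<omega> assume \<omega>: "\<omega> \<in> space M - ?good"
      hence w: "\<omega> \<in> space M" and gt: "norm (Gamma_op M X m (avg_seq Z n \<omega> - m))
         > 4 * (2 / (3 * real n) + 1 / sqrt (real n)) * L" by auto
      have "4 * L * sqrt (real n) = real n * (4 * (1 / sqrt (real n)) * L)"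
        using n by (simp add: field_simps)
      also have "\<dots> \<le> real n * (4 * (2 / (3 * real n) + 1 / sqrt (real n)) * L)"
        using L by (intro mult_left_mono mult_right_mono) auto
      also have "\<dots> < real n * norm (Gamma_op M X m (avg_seq Z n \<omega> - m))"
        using gt n by simp
      also have "\<dots> \<le> norm (noise_sum n \<omega>) + remainder (10 * C) n \<omega>"
        by (rule norm_Gamma_avg_le[OF n(1) w])
      finally have "norm (noise_sum n \<omega>) \<ge> 3 * L * sqrt (real n) \<or> remainder (10 * C) n \<omega> \<ge> L * sqrt (real n)"
        by linarith
      thus "\<omega> \<in> E1 \<union> E2" using w by (auto simp: E1_def E2_def)
    qed
    hence "prob (space M - ?good) \<le> prob E1 + prob E2"
      using E by (intro order_trans[OF finite_measure_mono measure_Un_le]) auto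
    also have "prob E1 \<le> 2 * exp (- (3 * L * sqrt (real n))\<^sup>2 / (2 * real n * 2\<^sup>2))"
      unfolding E1_def using n L by (intro azuma_hoeffding) auto
    also have "- (3 * L * sqrt (real n))\<^sup>2 / (2 * real n * 2\<^sup>2) = - (9 / 8 * L\<^sup>2)"
      using n by (simp add: power_mult_distrib)
    also have "2 * exp (- (9 / 8 * L\<^sup>2)) \<le> \<delta> / 2"
    proof -
      have "1 * L \<le> L * L" using L by (intro mult_right_mono) auto
      hence "- (9 / 8 * L\<^sup>2) \<le> - L" unfolding power2_eq_square using L by linarith
      hence "exp (- (9 / 8 * L\<^sup>2)) \<le> exp (- L)" by simp
      also have "exp (- L) = \<delta> / 4" using \<delta> by (simp add: L_def exp_minus)
      finally show ?thesis by simp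
    qed
    also have "prob E2 \<le> \<delta> / 2" unfolding E2_def by (rule N[OF n(2)])
    finally have "prob (space M - ?good) \<le> \<delta>" by simp
    thus ?thesis using prob_compl[OF good] by linarith
  qed
  thus ?thesis unfolding L_def by blast
qed

end

theorem theorem4p2:
  fixes M :: "'w measure"
    and X :: "'w \<Rightarrow> 'a::{real_inner, banach, second_countable_topology}"
    and Xs :: "nat \<Rightarrow> 'w \<Rightarrow> 'a"
    and Z :: "nat \<Rightarrow> 'w \<Rightarrow> 'a"
    and m :: 'a
    and C \<alpha> c\<^sub>\<gamma> :: real
    and \<gamma> :: "nat \<Rightarrow> real"
  assumes prob: "prob_space M"
    and X_rv: "X \<in> borel_measurable M"
    and copies: "\<And>n. n \<ge> 1 \<Longrightarrow> distr M borel (Xs n) = distr M borel X"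
    and indep: "prob_space.indep_vars M (\<lambda>_. borel) Xs {1..}"
    and cond_i: "\<And>h. \<exists>h'. h \<bullet> h' = 0 \<and> ext_variance M (\<lambda>\<omega>. h' \<bullet> X \<omega>) > 0"
    and C_pos: "C > 0"
    and cond_ii_1: "\<And>h. (\<integral>\<^sup>+\<omega>. inverse (ennreal (norm (X \<omega> - h))) \<partial>M) \<le> ennreal C"
    and cond_ii_2: "\<And>h. (\<integral>\<^sup>+\<omega>. inverse ((ennreal (norm (X \<omega> - h)))\<^sup>2) \<partial>M) \<le> ennreal C"
    and median: "is_geometric_median M X m"
    and alpha: "1/2 < \<alpha>" "\<alpha> < 1"
    and c_pos: "c\<^sub>\<gamma> > 0"
    and gamma: "\<And>n. n \<ge> 1 \<Longrightarrow> \<gamma> n = c\<^sub>\<gamma> * real n powr (- \<alpha>)"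
    and Z1_meas: "Z 1 \<in> borel_measurable (vimage_algebra (space M) (Xs 1) borel)"
    and Z1_bounded: "bounded (Z 1 ` space M)"
    and Z_rec: "\<And>n \<omega>. n \<ge> 1 \<Longrightarrow> \<omega> \<in> space M \<Longrightarrow>
        Z (n + 1) \<omega> = Z n \<omega>
          + \<gamma> n *\<^sub>R ((1 / norm (Xs (n + 1) \<omega> - Z n \<omega>)) *\<^sub>R (Xs (n + 1) \<omega> - Z n \<omega>))"
  shows "\<forall>\<delta>\<in>{0<..<1}. \<exists>n\<^sub>\<delta>. \<forall>n\<ge>n\<^sub>\<delta>.
     measure M {\<omega> \<in> space M. norm (Gamma_op M X m (avg_seq Z n \<omega> - m))
        \<le> 4 * (2 / (3 * real n) + 1 / sqrt (real n)) * ln (4 / \<delta>)} \<ge> 1 - \<delta>"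
proof -
  interpret prob_space M by (rule prob)
  interpret ind: independent_sequence M Xs
    by unfold_locales (rule indep)
  obtain B where B: "\<And>\<omega>. \<omega> \<in> space M \<Longrightarrow> norm (Z 1 \<omega>) \<le> B"
    using Z1_bounded by (auto simp: bounded_iff)
  interpret alg: median_recursion M X C m Xs Z \<alpha> c\<^sub>\<gamma> "B + norm m"
  proof
    have "sets (vimage_algebra (space M) (Xs 1) borel) \<subseteq> sets (ind.past 1)"
      using sets_image_in_sets[OF _ ind.Xs_past[of 1 1]] by simp
    hence "subalgebra (ind.past 1) (vimage_algebra (space M) (Xs 1) borel)"
      by (simp add: subalgebra_def)
    thus "Z 1 \<in> borel_measurable (ind.past 1)"
      by (rule measurable_from_subalg[OF _ Z1_meas])
    show "norm (Z 1 \<omega> - m) \<le> B + norm m" if "\<omega> \<in> space M" for \<omega>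
      using norm_triangle_ineq4[of "Z 1 \<omega>" m] B[OF that] by linarith
    show "Z (Suc n) \<omega> = Z n \<omega> + (c\<^sub>\<gamma> * real n powr - \<alpha>) *\<^sub>R sgn (Xs (Suc n) \<omega> - Z n \<omega>)"
      if "n \<ge> 1" "\<omega> \<in> space M" for n \<omega>
      using Z_rec[OF that] gamma[OF that(1)] by (simp add: sgn_div_norm inverse_eq_divide)
  qed (use X_rv C_pos cond_ii_1 cond_ii_2 cond_i median copies alpha c_pos in auto)
  show ?thesis
    using alg.confidence_ball by auto
qed

end
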